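(* The linear map $\chi:C(B_+)\otimes C(B_+)\to\mathbb{C}$ defined by $$\chi=(\epsilon\otimes\epsilon)\circ\exp\Big(\imath A\,\frac{\partial}{\partial p}\otimes\frac{\partial}{\partial g^{-1}}\Big),\qquad \chi^{-1}=(\epsilon\otimes\epsilon)\circ\exp\Big(\imath A\,\frac{\partial}{\partial p}\otimes\frac{\partial}{\partial g}\Big)$$ (with $\chi^{-1}$ its convolution inverse) is a unital 2-cocycle on $C(B_+)$, and $\mathbb{C}[x]\blacktriangleright\!\!\triangleleft_{\hbar,\mathsf{G}}\mathbb{C}[p]=C(B_+)^\chi$.
   Context: $\hbar,\mathsf G$ are constants ($\mathsf G\neq0$) and $A=\hbar/\mathsf G$; $\imath$ is the imaginary unit. $C(B_+)$ is the commutative Hopf algebra $\mathbb C[p,g,g^{-1}]$ with $\Delta p=p\otimes g+1\otimes p$, $\Delta g=g\otimes g$, $\epsilon(p)=0$, $\epsilon(g)=1$, $Sp=-pg^{-1}$, $Sg=g^{-1}$. The Planck scale Hopf algebra $\mathbb{C}[x]\blacktriangleright\!\!\triangleleft_{\hbar,\mathsf{G}}\mathbb{C}[p]$, in its algebraic form with $g=e^{-x/\mathsf G}$ and $g^{-1}$ used in place of $x$, is generated by $p,g,g^{-1}$ with relation $[p,g]=\imath A(1-g)g$ and the same formulae for $\Delta,\epsilon,S$ on the generators. $\frac{\partial}{\partial g^{-1}}$ denotes differentiation with respect to the variable $g^{-1}$, so $\big(\frac{\partial}{\partial g^{-1}}\big)^n g^s=\prod_{k=0}^{n-1}(-s-k)\,g^{s+n}$;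 the exponential series terminates on every element. On the basis $\{p^ng^r: n\in\mathbb N_0,r\in\mathbb Z\}$ this means $\chi(p^ng^r\otimes p^mg^s)=\delta_{m,0}(\imath A)^n\prod_{k=0}^{n-1}(-s-k)$ and $\chi^{-1}(p^ng^r\otimes p^mg^s)=\delta_{m,0}(\imath A)^n\prod_{k=0}^{n-1}(s-k)$. A unital 2-cocycle on a Hopf algebra $H$ is a convolution-invertible $\chi:H\otimes H\to\mathbb C$ with $\chi(g_{(1)}\otimes f_{(1)})\chi(h\otimes g_{(2)}f_{(2)})=\chi(h_{(1)}\otimes g_{(1)})\chi(h_{(2)}g_{(2)}\otimes f)$ and $\chi(1\otimes h)=\epsilon(h)$. $H^\chi$ is the Hopf algebra with the same coalgebra and unit as $H$ and product $h\bullet g=\chi(h_{(1)}\otimes g_{(1)})h_{(2)}g_{(2)}\chi^{-1}(h_{(3)}\otimes g_{(3)})$ and the correspondingly twisted antipode. *)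

theory Defs
  imports Complex_Main "HOL-Library.Poly_Mapping" "HOL-Library.Product_Plus"
begin

section \<open>Free complex vector spaces and their tensor products\<close>

type_synonym 'b vec = "'b \<Rightarrow>\<^sub>0 complex"

definition cscale :: "complex \<Rightarrow> 'b vec \<Rightarrow> 'b vec"  (infixr \<open>*\<^sub>c\<close> 75)
  where "c *\<^sub>c x = Poly_Mapping.map ((*) c) x"

lemma lookup_cscale [simp]: "Poly_Mapping.lookup (c *\<^sub>c x) b = c * Poly_Mapping.lookup x b"
  by (simp add: cscale_def Poly_Mapping.map.rep_eq when_def)

lemma vector_space_cscale: "vector_space (cscale :: complex \<Rightarrow> 'b vec \<Rightarrow> 'b vec)"
  by unfold_locales (auto intro!: poly_mapping_eqI simp: lookup_add algebra_simps)

lemmas module_cscale = vector_space_cscale[folded module_iff_vector_space]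

lemma cscale_0 [simp]: "0 *\<^sub>c x = 0" "c *\<^sub>c 0 = 0"
  by (auto intro!: poly_mapping_eqI)

lemma cscale_1 [simp]: "1 *\<^sub>c x = x"
  by (auto intro!: poly_mapping_eqI)

lemma cscale_cscale [simp]: "c *\<^sub>c d *\<^sub>c x = (c * d) *\<^sub>c x"
  by (auto intro!: poly_mapping_eqI)

abbreviation bvec :: "'b \<Rightarrow> 'b vec"
  where "bvec b \<equiv> Poly_Mapping.single b 1"

abbreviation clinear :: "('b vec \<Rightarrow> 'c vec) \<Rightarrow> bool"
  where "clinear \<equiv> Vector_Spaces.linear cscale cscale"

abbreviation cfunctional :: "('b vec \<Rightarrow> complex) \<Rightarrow> bool"
  where "cfunctional \<equiv> Vector_Spaces.linear cscale (*)"

abbreviation csubspace :: "'b vec set \<Rightarrow> bool"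
  where "csubspace \<equiv> module.subspace cscale"

abbreviation cspan :: "'b vec set \<Rightarrow> 'b vec set"
  where "cspan \<equiv> module.span cscale"

definition lin_ext :: "('b \<Rightarrow> 'c vec) \<Rightarrow> 'b vec \<Rightarrow> 'c vec"
  where "lin_ext f x = (\<Sum>b\<in>Poly_Mapping.keys x. Poly_Mapping.lookup x b *\<^sub>c f b)"

definition fun_ext :: "('b \<Rightarrow> complex) \<Rightarrow> 'b vec \<Rightarrow> complex"
  where "fun_ext f x = (\<Sum>b\<in>Poly_Mapping.keys x. Poly_Mapping.lookup x b * f b)"

lemma lin_ext_bvec [simp]: "lin_ext f (bvec b) = f b"
  by (simp add: lin_ext_def)

lemma fun_ext_bvec [simp]: "fun_ext f (bvec b) = f b"
  by (simp add: fun_ext_def)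

lemma lin_ext_cscale: "lin_ext f (c *\<^sub>c x) = c *\<^sub>c lin_ext f x"
proof (cases "c = 0")
  case False
  then have "Poly_Mapping.keys (c *\<^sub>c x) = Poly_Mapping.keys x"
    by (auto simp: in_keys_iff)
  then show ?thesis
    by (simp add: lin_ext_def module.scale_sum_right[OF module_cscale])
qed (simp add: lin_ext_def)

lemma fun_ext_cscale: "fun_ext f (c *\<^sub>c x) = c * fun_ext f x"
proof (cases "c = 0")
  case False
  then have "Poly_Mapping.keys (c *\<^sub>c x) = Poly_Mapping.keys x"
    by (auto simp: in_keys_iff)
  then show ?thesis
    by (simp add: fun_ext_def sum_distrib_left mult.assoc)
qed (simp add: fun_ext_def)

text \<open>The tensor product of the spaces with bases \<open>'b\<close> and \<open>'c\<close> is the space with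
  basis \<open>'b \<times> 'c\<close>, where \<open>(b, c)\<close> stands for \<open>b \<otimes> c\<close>.\<close>

definition tens :: "'b vec \<Rightarrow> 'c vec \<Rightarrow> ('b \<times> 'c) vec"  (infixr \<open>\<otimes>\<close> 72)
  where "x \<otimes> y = lin_ext (\<lambda>b. lin_ext (\<lambda>c. bvec (b, c)) y) x"

definition tmap :: "('b vec \<Rightarrow> 'd vec) \<Rightarrow> ('c vec \<Rightarrow> 'e vec) \<Rightarrow> ('b \<times> 'c) vec \<Rightarrow> ('d \<times> 'e) vec"
  where "tmap f g = lin_ext (\<lambda>(b, c). f (bvec b) \<otimes> g (bvec c))"

definition tfun :: "('b vec \<Rightarrow> complex) \<Rightarrow> ('c vec \<Rightarrow> complex) \<Rightarrow> ('b \<times> 'c) vec \<Rightarrow> complex"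
  where "tfun f g = fun_ext (\<lambda>(b, c). f (bvec b) * g (bvec c))"

definition tassoc :: "(('b \<times> 'c) \<times> 'd) vec \<Rightarrow> ('b \<times> ('c \<times> 'd)) vec"
  where "tassoc = lin_ext (\<lambda>((b, c), d). bvec (b, (c, d)))"

text \<open>\<open>(V/N) \<otimes> (W/M)\<close> is \<open>(V \<otimes> W) / tnull N M\<close>, since \<open>tnull N M\<close> is \<open>N \<otimes> W + V \<otimes> M\<close>.\<close>

definition tnull :: "'b vec set \<Rightarrow> 'c vec set \<Rightarrow> ('b \<times> 'c) vec set"
  where "tnull N M = cspan {x \<otimes> y | x y. x \<in> N \<or> y \<in> M}"

section \<open>Hopf algebras\<close>

text \<open>The underlying vector space is \<open>V/N\<close>, where \<open>V\<close> is free on the basis \<open>'b\<close> and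
  \<open>N = null H\<close> is a subspace; the structure maps are given on representatives in \<open>V\<close>.
  Every complex vector space is of this form (with \<open>N = {0}\<close>, by choosing a basis); a
  non-trivial \<open>N\<close> serves algebras given by generators and relations.
  Identities in \<open>V/N\<close> are stated as membership of a difference in \<open>N\<close>.\<close>

record 'b hopf =
  null :: "'b vec set"
  mult :: "'b vec \<Rightarrow> 'b vec \<Rightarrow> 'b vec"
  unit :: "'b vec"
  comult :: "'b vec \<Rightarrow> ('b \<times> 'b) vec"
  counit :: "'b vec \<Rightarrow> complex"
  antipode :: "'b vec \<Rightarrow> 'b vec"

definition mult_lin :: "('b vec \<Rightarrow> 'b vec \<Rightarrow> 'b vec) \<Rightarrow> ('b \<times> 'b) vec \<Rightarrow> 'b vec"
  where "mult_lin m = lin_ext (\<lambda>(a, b). m (bvec a) (bvec b))"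

definition tmult :: "('b vec \<Rightarrow> 'b vec \<Rightarrow> 'b vec) \<Rightarrow>
    ('b \<times> 'b) vec \<Rightarrow> ('b \<times> 'b) vec \<Rightarrow> ('b \<times> 'b) vec"
  where "tmult m s t =
    lin_ext (\<lambda>(a, b). lin_ext (\<lambda>(c, d). m (bvec a) (bvec c) \<otimes> m (bvec b) (bvec d)) t) s"

locale hopf_algebra =
  fixes H :: "'b hopf"
  assumes null_subspace: "csubspace (null H)"
    and mult_linear_left: "\<And>y. clinear (\<lambda>x. mult H x y)"
    and mult_linear_right: "\<And>x. clinear (mult H x)"
    and comult_linear: "clinear (comult H)"
    and counit_linear: "cfunctional (counit H)"
    and antipode_linear: "clinear (antipode H)"
    and mult_null_left: "\<And>x y. x \<in> null H \<Longrightarrow> mult H x y \<in> null H"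
    and mult_null_right: "\<And>x y. y \<in> null H \<Longrightarrow> mult H x y \<in> null H"
    and comult_null: "\<And>x. x \<in> null H \<Longrightarrow> comult H x \<in> tnull (null H) (null H)"
    and counit_null: "\<And>x. x \<in> null H \<Longrightarrow> counit H x = 0"
    and antipode_null: "\<And>x. x \<in> null H \<Longrightarrow> antipode H x \<in> null H"
    and mult_assoc:
      "\<And>x y z. mult H (mult H x y) z - mult H x (mult H y z) \<in> null H"
    and unit_left: "\<And>x. mult H (unit H) x - x \<in> null H"
    and unit_right: "\<And>x. mult H x (unit H) - x \<in> null H"
    and coassoc:
      "\<And>x. tassoc (tmap (comult H) id (comult H x)) - tmap id (comult H) (comult H x)
         \<in> tnull (null H) (tnull (null H) (null H))"
    and counit_left:
      "\<And>x. lin_ext (\<lambda>(a, b). counit H (bvec a) *\<^sub>c bvec b) (comult H x) - x \<in> null H"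
    and counit_right:
      "\<And>x. lin_ext (\<lambda>(a, b). counit H (bvec b) *\<^sub>c bvec a) (comult H x) - x \<in> null H"
    and comult_mult:
      "\<And>x y. comult H (mult H x y) - tmult (mult H) (comult H x) (comult H y)
         \<in> tnull (null H) (null H)"
    and comult_unit: "comult H (unit H) - unit H \<otimes> unit H \<in> tnull (null H) (null H)"
    and counit_mult: "\<And>x y. counit H (mult H x y) = counit H x * counit H y"
    and counit_unit: "counit H (unit H) = 1"
    and antipode_left:
      "\<And>x. mult_lin (mult H) (tmap (antipode H) id (comult H x)) - counit H x *\<^sub>c unit H \<in> null H"
    and antipode_right:
      "\<And>x. mult_lin (mult H) (tmap id (antipode H) (comult H x)) - counit H x *\<^sub>c unit H \<in> null H"

definition hopf_iso :: "'b hopf \<Rightarrow> 'c hopf \<Rightarrow> ('b vec \<Rightarrow> 'c vec) \<Rightarrow> bool"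
  where "hopf_iso H K f \<longleftrightarrow>
    clinear f \<and>
    (\<forall>x. f x \<in> null K \<longleftrightarrow> x \<in> null H) \<and>
    (\<forall>y. \<exists>x. f x - y \<in> null K) \<and>
    (\<forall>x y. f (mult H x y) - mult K (f x) (f y) \<in> null K) \<and>
    f (unit H) - unit K \<in> null K \<and>
    (\<forall>x. tmap f f (comult H x) - comult K (f x) \<in> tnull (null K) (null K)) \<and>
    (\<forall>x. counit K (f x) = counit H x) \<and>
    (\<forall>x. f (antipode H x) - antipode K (f x) \<in> null K)"

section \<open>2-cocycles and cocycle twists\<close>

text \<open>\<open>comult2 H\<close> is the coproduct of the tensor product coalgebra:
  \<open>x \<otimes> y \<mapsto> (x\<^sub>1 \<otimes> y\<^sub>1) \<otimes> (x\<^sub>2 \<otimes> y\<^sub>2)\<close>.\<close>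

definition comult2 :: "'b hopf \<Rightarrow> ('b \<times> 'b) vec \<Rightarrow> (('b \<times> 'b) \<times> ('b \<times> 'b)) vec"
  where "comult2 H t =
    lin_ext (\<lambda>((a, b), (c, d)). bvec ((a, c), (b, d))) (tmap (comult H) (comult H) t)"

definition tfunctional :: "'b hopf \<Rightarrow> (('b \<times> 'b) vec \<Rightarrow> complex) \<Rightarrow> bool"
  where "tfunctional H \<chi> \<longleftrightarrow>
    cfunctional \<chi> \<and> (\<forall>t\<in>tnull (null H) (null H). \<chi> t = 0)"

definition conv :: "'b hopf \<Rightarrow> (('b \<times> 'b) vec \<Rightarrow> complex) \<Rightarrow> (('b \<times> 'b) vec \<Rightarrow> complex) \<Rightarrow>
    ('b \<times> 'b) vec \<Rightarrow> complex"
  where "conv H \<chi> \<psi> t = tfun \<chi> \<psi> (comult2 H t)"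

definition conv_inverse ::
    "'b hopf \<Rightarrow> (('b \<times> 'b) vec \<Rightarrow> complex) \<Rightarrow> (('b \<times> 'b) vec \<Rightarrow> complex) \<Rightarrow> bool"
  where "conv_inverse H \<chi> \<psi> \<longleftrightarrow>
    tfunctional H \<psi> \<and>
    conv H \<chi> \<psi> = tfun (counit H) (counit H) \<and>
    conv H \<psi> \<chi> = tfun (counit H) (counit H)"

text \<open>In the cocycle identity, the left-hand side is \<open>\<chi>(g\<^sub>1 \<otimes> f\<^sub>1) \<chi>(h \<otimes> g\<^sub>2 f\<^sub>2)\<close> and the
  right-hand side is \<open>\<chi>(h\<^sub>1 \<otimes> g\<^sub>1) \<chi>(h\<^sub>2 g\<^sub>2 \<otimes> f)\<close>.\<close>

definition unital_2_cocycle :: "'b hopf \<Rightarrow> (('b \<times> 'b) vec \<Rightarrow> complex) \<Rightarrow> bool"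
  where "unital_2_cocycle H \<chi> \<longleftrightarrow>
    tfunctional H \<chi> \<and>
    (\<exists>\<psi>. conv_inverse H \<chi> \<psi>) \<and>
    (\<forall>h g f.
       fun_ext (\<lambda>(u, (c, d)). \<chi> (bvec u) * \<chi> (h \<otimes> mult H (bvec c) (bvec d))) (comult2 H (g \<otimes> f)) =
       fun_ext (\<lambda>(u, (c, d)). \<chi> (bvec u) * \<chi> (mult H (bvec c) (bvec d) \<otimes> f)) (comult2 H (h \<otimes> g))) \<and>
    (\<forall>h. \<chi> (unit H \<otimes> h) = counit H h)"

text \<open>\<open>twist_mult H \<chi> \<psi> h g\<close> is \<open>\<chi>(h\<^sub>1 \<otimes> g\<^sub>1) h\<^sub>2 g\<^sub>2 \<psi>(h\<^sub>3 \<otimes> g\<^sub>3)\<close>, where \<open>\<psi>\<close> is the convolution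
  inverse of \<open>\<chi>\<close>. The twisted antipode is \<open>h \<mapsto> U(h\<^sub>1) S(h\<^sub>2) U'(h\<^sub>3)\<close> with
  \<open>U(h) = \<chi>(h\<^sub>1 \<otimes> S h\<^sub>2)\<close> and its convolution inverse \<open>U'(h) = \<psi>(S h\<^sub>1 \<otimes> h\<^sub>2)\<close>.\<close>

definition twist_mult :: "'b hopf \<Rightarrow> (('b \<times> 'b) vec \<Rightarrow> complex) \<Rightarrow> (('b \<times> 'b) vec \<Rightarrow> complex) \<Rightarrow>
    'b vec \<Rightarrow> 'b vec \<Rightarrow> 'b vec"
  where "twist_mult H \<chi> \<psi> h g =
    lin_ext (\<lambda>((u, (c, d)), w). (\<chi> (bvec u) * \<psi> (bvec w)) *\<^sub>c mult H (bvec c) (bvec d))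
      (tmap (comult2 H) id (comult2 H (h \<otimes> g)))"

definition twist_antipode :: "'b hopf \<Rightarrow> (('b \<times> 'b) vec \<Rightarrow> complex) \<Rightarrow> (('b \<times> 'b) vec \<Rightarrow> complex) \<Rightarrow>
    'b vec \<Rightarrow> 'b vec"
  where "twist_antipode H \<chi> \<psi> h =
    lin_ext (\<lambda>((a, b), c).
        (\<chi> (tmap id (antipode H) (comult H (bvec a))) *
         \<psi> (tmap (antipode H) id (comult H (bvec c)))) *\<^sub>c antipode H (bvec b))
      (tmap (comult H) id (comult H h))"

definition cocycle_twist :: "'b hopf \<Rightarrow> (('b \<times> 'b) vec \<Rightarrow> complex) \<Rightarrow> (('b \<times> 'b) vec \<Rightarrow> complex) \<Rightarrow>
    'b hopf"
  where "cocycle_twist H \<chi> \<psi> =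
    H\<lparr>mult := twist_mult H \<chi> \<psi>, antipode := twist_antipode H \<chi> \<psi>\<rparr>"

section \<open>The Hopf algebra \<open>C(B\<^sub>+)\<close>\<close>

text \<open>The basis element \<open>(n, r)\<close> stands for the monomial \<open>p\<^sup>n g\<^sup>r\<close>. Under this identification the
  ring multiplication of \<^typ>\<open>(nat \<times> int) vec\<close> is that of \<open>\<complex>[p, g, g\<^sup>-\<^sup>1]\<close>, and the one of
  \<^typ>\<open>((nat \<times> int) \<times> (nat \<times> int)) vec\<close> is that of its tensor square. The maps
  below are the multiplicative extensions of \<open>\<Delta>p = p \<otimes> g + 1 \<otimes> p\<close>, \<open>\<Delta>g = g \<otimes> g\<close>, \<open>\<epsilon>(p) = 0\<close>,
  \<open>\<epsilon>(g) = 1\<close>, \<open>Sp = - p g\<^sup>-\<^sup>1\<close>, \<open>Sg = g\<^sup>-\<^sup>1\<close>, evaluated on monomials.\<close>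

definition CB :: "(nat \<times> int) hopf"
  where "CB =
    \<lparr>null = {0},
     mult = (*),
     unit = 1,
     comult = lin_ext (\<lambda>(n, r).
       (bvec (1, 0) \<otimes> bvec (0, 1) + bvec (0, 0) \<otimes> bvec (1, 0)) ^ n * (bvec (0, r) \<otimes> bvec (0, r))),
     counit = fun_ext (\<lambda>(n, r). if n = 0 then 1 else 0),
     antipode = lin_ext (\<lambda>(n, r). (- bvec (1, - 1)) ^ n * bvec (0, - r))\<rparr>"

definition d_p :: "(nat \<times> int) vec \<Rightarrow> (nat \<times> int) vec"
  where "d_p = lin_ext (\<lambda>(n, r). of_nat n *\<^sub>c bvec (n - 1, r))"

definition d_g :: "(nat \<times> int) vec \<Rightarrow> (nat \<times> int) vec"
  where "d_g = lin_ext (\<lambda>(n, r). of_int r *\<^sub>c bvec (n, r - 1))"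

text \<open>Differentiation with respect to \<open>g\<^sup>-\<^sup>1\<close>, where \<open>g\<^sup>r = (g\<^sup>-\<^sup>1)\<^sup>-\<^sup>r\<close>.\<close>

definition d_ginv :: "(nat \<times> int) vec \<Rightarrow> (nat \<times> int) vec"
  where "d_ginv = lin_ext (\<lambda>(n, r). of_int (- r) *\<^sub>c bvec (n, r + 1))"

text \<open>The exponential series of a locally nilpotent operator: \<^const>\<open>Sum_any\<close> sums the finitely
  many non-zero terms.\<close>

definition exp_op :: "('b vec \<Rightarrow> 'b vec) \<Rightarrow> 'b vec \<Rightarrow> 'b vec"
  where "exp_op D t = Sum_any (\<lambda>k. (1 / fact k) *\<^sub>c (D ^^ k) t)"

definition chi :: "complex \<Rightarrow> ((nat \<times> int) \<times> (nat \<times> int)) vec \<Rightarrow> complex"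
  where "chi A = tfun (counit CB) (counit CB) \<circ> exp_op (\<lambda>t. (\<i> * A) *\<^sub>c tmap d_p d_ginv t)"

definition chi_inv :: "complex \<Rightarrow> ((nat \<times> int) \<times> (nat \<times> int)) vec \<Rightarrow> complex"
  where "chi_inv A = tfun (counit CB) (counit CB) \<circ> exp_op (\<lambda>t. (\<i> * A) *\<^sub>c tmap d_p d_g t)"

lemma exp_op_eigen:
  assumes "\<And>k. (D ^^ k) t = c k *\<^sub>c bvec (b k)" and "\<And>k. n < k \<Longrightarrow> c k = 0"
  shows "exp_op D t = (\<Sum>k\<le>n. (c k / fact k) *\<^sub>c bvec (b k))"
proof -
  have "exp_op D t = Sum_any (\<lambda>k. (c k / fact k) *\<^sub>c bvec (b k))"
    by (simp add: exp_op_def assms(1))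
  also have "\<dots> = (\<Sum>k\<le>n. (c k / fact k) *\<^sub>c bvec (b k))"
  proof (rule Sum_any.expand_superset)
    show "{k. (c k / fact k) *\<^sub>c bvec (b k) \<noteq> 0} \<subseteq> {..n}"
      using assms(2) by (force simp: not_less[symmetric])
  qed simp
  finally show ?thesis .
qed

lemma fun_ext_sum: "fun_ext f (sum g I) = (\<Sum>i\<in>I. fun_ext f (g i))"
proof -
  have add: "fun_ext f (x + y) = fun_ext f x + fun_ext f y" for x y
  proof -
    let ?K = "Poly_Mapping.keys x \<union> Poly_Mapping.keys y"
    have *: "fun_ext f z = (\<Sum>b\<in>?K. Poly_Mapping.lookup z b * f b)"
      if "Poly_Mapping.keys z \<subseteq> ?K" for z
      unfolding fun_ext_def using that
      by (intro sum.mono_neutral_left) (auto simp: in_keys_iff)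
    show ?thesis
      by (simp add: * Poly_Mapping.keys_add lookup_add algebra_simps sum.distrib)
  qed
  show ?thesis
    by (induction I rule: infinite_finite_induct) (auto simp: add fun_ext_def[of _ 0])
qed

lemma tens_bvec [simp]: "bvec b \<otimes> bvec c = bvec (b, c)"
  by (simp add: tens_def)

lemma tens_cscale [simp]: "(a *\<^sub>c bvec b) \<otimes> (d *\<^sub>c bvec c) = (a * d) *\<^sub>c bvec (b, c)"
  by (simp add: tens_def lin_ext_cscale)

lemma tmap_bvec [simp]: "tmap f g (bvec (b, c)) = f (bvec b) \<otimes> g (bvec c)"
  by (simp add: tmap_def)

lemma tmap_cscale: "tmap f g (c *\<^sub>c x) = c *\<^sub>c tmap f g x"
  by (simp add: tmap_def lin_ext_cscale)

lemma chi_bvec: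
  "chi A (bvec ((n, r), (m, s))) =
    (if m = 0 then (\<i> * A) ^ n * (\<Prod>k<n. of_int (- s - int k)) else 0)"
proof -
  define c :: "nat \<Rightarrow> complex" where
    "c k = (\<i> * A) ^ k * (\<Prod>j<k. of_nat (n - j)) * (\<Prod>j<k. of_int (- s - int j))" for k
  have pow: "((\<lambda>t. (\<i> * A) *\<^sub>c tmap d_p d_ginv t) ^^ k) (bvec ((n, r), (m, s))) =
      c k *\<^sub>c bvec ((n - k, r), (m, s + int k))" for k
    by (induction k) (simp_all add: c_def tmap_cscale d_p_def d_ginv_def algebra_simps)
  have zero: "c k = 0" if "n < k" for k
    using that by (auto simp: c_def intro!: bexI[of _ n])
  have "(\<Prod>j<n. of_nat (n - j)) = (fact n :: complex)"
    by (simp add: fact_prod_rev atLeast0LessThan)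
  then have "c n / fact n = (\<i> * A) ^ n * (\<Prod>j<n. of_int (- s - int j))"
    by (simp add: c_def)
  moreover have "chi A (bvec ((n, r), (m, s))) =
      (\<Sum>k\<le>n. c k / fact k * (if k = n \<and> m = 0 then 1 else 0))"
    by (auto simp: chi_def exp_op_eigen[OF pow zero] tfun_def fun_ext_sum fun_ext_cscale CB_def
        intro!: sum.cong)
  ultimately show ?thesis
    by (auto simp: if_distrib[of "(*) _"] cong: if_cong)
qed

lemma chi_inv_bvec:
  "chi_inv A (bvec ((n, r), (m, s))) =
    (if m = 0 then (\<i> * A) ^ n * (\<Prod>k<n. of_int (s - int k)) else 0)"
proof -
  define c :: "nat \<Rightarrow> complex" where
    "c k = (\<i> * A) ^ k * (\<Prod>j<k. of_nat (n - j)) * (\<Prod>j<k. of_int (s - int j))" for k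
  have pow: "((\<lambda>t. (\<i> * A) *\<^sub>c tmap d_p d_g t) ^^ k) (bvec ((n, r), (m, s))) =
      c k *\<^sub>c bvec ((n - k, r), (m, s - int k))" for k
    by (induction k) (simp_all add: c_def tmap_cscale d_p_def d_g_def algebra_simps)
  have zero: "c k = 0" if "n < k" for k
    using that by (auto simp: c_def intro!: bexI[of _ n])
  have "(\<Prod>j<n. of_nat (n - j)) = (fact n :: complex)"
    by (simp add: fact_prod_rev atLeast0LessThan)
  then have "c n / fact n = (\<i> * A) ^ n * (\<Prod>j<n. of_int (s - int j))"
    by (simp add: c_def)
  moreover have "chi_inv A (bvec ((n, r), (m, s))) =
      (\<Sum>k\<le>n. c k / fact k * (if k = n \<and> m = 0 then 1 else 0))"
    by (auto simp: chi_inv_def exp_op_eigen[OF pow zero] tfun_def fun_ext_sum fun_ext_cscale CB_def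
        intro!: sum.cong)
  ultimately show ?thesis
    by (auto simp: if_distrib[of "(*) _"] cong: if_cong)
qed

section \<open>The Planck scale Hopf algebra\<close>

text \<open>It is presented as the free algebra on \<open>p\<close>, \<open>g\<close>, \<open>g\<^sup>-\<^sup>1\<close> (with basis the words in these letters)
  modulo the two-sided ideal generated by the relations.\<close>

datatype letter = P | G | Ginv

definition free_mult :: "letter list vec \<Rightarrow> letter list vec \<Rightarrow> letter list vec"
  where "free_mult x y = lin_ext (\<lambda>u. lin_ext (\<lambda>v. bvec (u @ v)) y) x"

definition planck_relators :: "complex \<Rightarrow> letter list vec set"
  where "planck_relators A =
    {bvec [G, Ginv] - bvec [],
     bvec [Ginv, G] - bvec [],
     (bvec [P, G] - bvec [G, P]) -
       (\<i> * A) *\<^sub>c free_mult (bvec [] - bvec [G]) (bvec [G])}"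

definition planck_ideal :: "complex \<Rightarrow> letter list vec set"
  where "planck_ideal A =
    cspan {free_mult (free_mult x r) y | x r y. r \<in> planck_relators A}"

fun letter_comult :: "letter \<Rightarrow> (letter list \<times> letter list) vec" where
  "letter_comult P = bvec [P] \<otimes> bvec [G] + bvec [] \<otimes> bvec [P]"
| "letter_comult G = bvec [G] \<otimes> bvec [G]"
| "letter_comult Ginv = bvec [Ginv] \<otimes> bvec [Ginv]"

fun letter_counit :: "letter \<Rightarrow> complex" where
  "letter_counit P = 0"
| "letter_counit G = 1"
| "letter_counit Ginv = 1"

fun letter_antipode :: "letter \<Rightarrow> letter list vec" where
  "letter_antipode P = - bvec [P, Ginv]"
| "letter_antipode G = bvec [Ginv]"
| "letter_antipode Ginv = bvec [G]"

text \<open>\<open>\<Delta>\<close> and \<open>\<epsilon>\<close> extend multiplicatively from the letters, \<open>S\<close> anti-multiplicatively.\<close>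

definition planck :: "complex \<Rightarrow> letter list hopf"
  where "planck A =
    \<lparr>null = planck_ideal A,
     mult = free_mult,
     unit = bvec [],
     comult = lin_ext (\<lambda>w.
       foldr (\<lambda>l t. tmult free_mult (letter_comult l) t) w (bvec [] \<otimes> bvec [])),
     counit = fun_ext (\<lambda>w. prod_list (map letter_counit w)),
     antipode = lin_ext (\<lambda>w. foldr (\<lambda>l x. free_mult x (letter_antipode l)) w (bvec []))\<rparr>"

end

theory Submission
  imports "HOL-Computational_Algebra.Formal_Power_Series" Defs
begin

text \<open>Write \<open>a = \<i> A\<close>. The cocycle twist and the Planck scale Hopf algebra are both identified
  with one explicit Hopf algebra \<open>planck_model a\<close> on the monomials \<open>p\<^sup>n g\<^sup>r\<close>, which has the
  coalgebra of \<open>C(B\<^sub>+)\<close>. In it, left multiplication by \<open>g\<^sup>r\<close> is the commutative one, and left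
  multiplication by \<open>p\<close> is the operator \<open>X = p + a (p \<partial>\<^sub>p + (g - g\<^sup>2) \<partial>\<^sub>g)\<close>, so that
  \<open>[X, g] = a (1 - g) g\<close>. The monomial \<open>p\<^sup>n g\<^sup>r\<close> acts on the left as
  \<open>g\<^sup>r X (X - a) \<cdots> (X - (n - 1) a)\<close> (\<open>dmult\<close>).

  The Hopf axioms of \<open>planck_model a\<close> are checked on the generating left multiplications
  \<open>g\<^sup>r\<close> and \<open>X\<close> (\<open>gen_induct\<close>): associativity because left multiplication by \<open>X y\<close> is \<open>X\<close>
  after left multiplication by \<open>y\<close>; multiplicativity of \<open>\<Delta>\<close> because \<open>\<Delta>\<close> intertwines \<open>X\<close> with
  \<open>X \<otimes> g + 1 \<otimes> X\<close> (\<open>Delta_left_p\<close>); the antipode because it is anti-multiplicative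
  (\<open>dantipode_dmult\<close>). At \<open>a = 0\<close> the model is \<open>C(B\<^sub>+)\<close> itself, so this also proves that
  \<open>C(B\<^sub>+)\<close> is a Hopf algebra.

  Both \<open>\<chi>\<close> and \<open>\<chi>\<^sup>-\<^sup>1\<close> belong to the family of functionals \<open>gpair a c\<close>, which vanish when the
  second argument contains \<open>p\<close> and send \<open>p\<^sup>n g\<^sup>r \<otimes> g\<^sup>s\<close> to \<open>a\<^sup>n n!\<close> times the generalised binomial
  coefficient of \<open>c s\<close> over \<open>n\<close>; they are \<open>c = - 1\<close> and \<open>c = 1\<close>. By Vandermonde's identity
  convolution adds the parameters \<open>c\<close> (\<open>conv_gpair\<close>), and \<open>c = 0\<close> gives \<open>\<epsilon> \<otimes> \<epsilon>\<close>. The cocycle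
  identity on monomials is Vandermonde's identity again (\<open>cocycle_gpair\<close>).

  The twisted product and antipode of a monomial are sums over \<open>i + j + k = n\<close> that come from the
  twofold coproduct of \<open>p\<^sup>n g\<^sup>r\<close>. They satisfy the first-order recursions in \<open>n\<close> that define the
  product and the antipode of \<open>planck_model a\<close> (\<open>left_pn_sum\<close>, \<open>antipode_mon_sum\<close>), hence
  the twist is \<open>planck_model a\<close> (\<open>cocycle_twist_eq\<close>).

  Finally, sending words in \<open>p\<close>, \<open>g\<close>, \<open>g\<^sup>-\<^sup>1\<close> to products in \<open>planck_model a\<close> is compatible with all
  structure maps, and its kernel is exactly the ideal of relations, because modulo that ideal
  every word can be brought to normal order (\<open>planck_ideal_eq_kernel\<close>). Hopf algebra structures
  and isomorphisms transfer along such a surjection (\<open>hopf_transfer\<close>); for the axioms stated in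
  tensor powers of the quotient this uses the kernel of \<open>f \<otimes> g\<close> (\<open>tnull_kernel\<close>).\<close>

section \<open>Linear maps between free vector spaces\<close>

lemma vec_expand: "x = (\<Sum>b\<in>Poly_Mapping.keys x. Poly_Mapping.lookup x b *\<^sub>c bvec b)"
  by (rule poly_mapping_eqI)
    (auto simp: lookup_sum lookup_single when_def in_keys_iff if_distrib[of "(*) _"] cong: if_cong)

lemma vec_induct [case_names zero add scale basis]:
  assumes "Q 0" and "\<And>x y. Q x \<Longrightarrow> Q y \<Longrightarrow> Q (x + y)" and "\<And>c x. Q x \<Longrightarrow> Q (c *\<^sub>c x)"
    and "\<And>b. Q (bvec b)"
  shows "Q x"
proof -
  have "Q (\<Sum>b\<in>B. Poly_Mapping.lookup x b *\<^sub>c bvec b)" if "finite B" for B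
    using that by (induction B) (auto intro: assms)
  then show ?thesis
    using vec_expand[of x] by (metis finite_keys)
qed

lemma cscale_add_right [simp]: "c *\<^sub>c (x + y) = c *\<^sub>c x + c *\<^sub>c y"
  and cscale_minus_right [simp]: "c *\<^sub>c (- x) = - (c *\<^sub>c x)"
  and cscale_diff_right [simp]: "c *\<^sub>c (x - y) = c *\<^sub>c x - c *\<^sub>c y"
  and cscale_minus_left [simp]: "(- c) *\<^sub>c x = - (c *\<^sub>c x)"
  and cscale_add_left: "(c + d) *\<^sub>c x = c *\<^sub>c x + d *\<^sub>c x"
  and cscale_diff_left: "(c - d) *\<^sub>c x = c *\<^sub>c x - d *\<^sub>c x"
  by (auto intro!: poly_mapping_eqI simp: lookup_add lookup_minus algebra_simps)

lemma cscale_sum_right: "c *\<^sub>c sum f I = (\<Sum>i\<in>I. c *\<^sub>c f i)"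
  by (induction I rule: infinite_finite_induct) auto

lemma clinear_iff:
  "clinear f \<longleftrightarrow> (\<forall>x y. f (x + y) = f x + f y) \<and> (\<forall>c x. f (c *\<^sub>c x) = c *\<^sub>c f x)"
  by (auto simp: Vector_Spaces.linear_iff vector_space_cscale)

lemma clinearI:
  "(\<And>x y. f (x + y) = f x + f y) \<Longrightarrow> (\<And>c x. f (c *\<^sub>c x) = c *\<^sub>c f x) \<Longrightarrow> clinear f"
  by (simp add: clinear_iff)

lemma clinear_add: "clinear f \<Longrightarrow> f (x + y) = f x + f y"
  and clinear_scale: "clinear f \<Longrightarrow> f (c *\<^sub>c x) = c *\<^sub>c f x"
  by (auto simp: clinear_iff)

lemma clinear_zero: "clinear f \<Longrightarrow> f 0 = 0"
  using clinear_scale[of f 0 0] by simp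

lemma clinear_minus: "clinear f \<Longrightarrow> f (- x) = - f x"
  using clinear_scale[of f "-1" x] by simp

lemma clinear_diff: "clinear f \<Longrightarrow> f (x - y) = f x - f y"
  using clinear_add[of f x "- y"] by (simp add: clinear_minus)

lemma clinear_sum: "clinear f \<Longrightarrow> f (sum g I) = (\<Sum>i\<in>I. f (g i))"
  by (induction I rule: infinite_finite_induct) (auto simp: clinear_add clinear_zero)

lemmas clinear_simps =
  clinear_add clinear_scale clinear_zero clinear_minus clinear_diff clinear_sum

lemma clinear_eqI:
  assumes "clinear f" "clinear g" "\<And>b. f (bvec b) = g (bvec b)"
  shows "f x = g x"
  using assms(3) by (induction x rule: vec_induct) (simp_all add: clinear_simps[OF assms(1)] clinear_simps[OF assms(2)])

lemma cfunctional_iff: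
  "cfunctional f \<longleftrightarrow> (\<forall>x y. f (x + y) = f x + f y) \<and> (\<forall>c x. f (c *\<^sub>c x) = c * f x)"
proof -
  have "vector_space ((*) :: complex \<Rightarrow> complex \<Rightarrow> complex)"
    by unfold_locales (auto simp: algebra_simps)
  then show ?thesis
    by (simp add: Vector_Spaces.linear_iff vector_space_cscale)
qed

lemma cfunctional_add: "cfunctional f \<Longrightarrow> f (x + y) = f x + f y"
  and cfunctional_scale: "cfunctional f \<Longrightarrow> f (c *\<^sub>c x) = c * f x"
  by (auto simp: cfunctional_iff)

lemma cfunctional_zero: "cfunctional f \<Longrightarrow> f 0 = 0"
  using cfunctional_scale[of f 0 0] by simp

lemma cfunctional_sum: "cfunctional f \<Longrightarrow> f (sum g I) = (\<Sum>i\<in>I. f (g i))"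
  by (induction I rule: infinite_finite_induct) (auto simp: cfunctional_add cfunctional_zero)

lemmas cfunctional_simps = cfunctional_add cfunctional_scale cfunctional_zero cfunctional_sum

lemma cfunctional_eqI:
  assumes "cfunctional f" "cfunctional g" "\<And>b. f (bvec b) = g (bvec b)"
  shows "f x = g x"
  using assms(3) by (induction x rule: vec_induct) (simp_all add: cfunctional_simps[OF assms(1)] cfunctional_simps[OF assms(2)])

lemma lin_ext_superset:
  assumes "finite K" "Poly_Mapping.keys x \<subseteq> K"
  shows "lin_ext f x = (\<Sum>b\<in>K. Poly_Mapping.lookup x b *\<^sub>c f b)"
  unfolding lin_ext_def using assms
  by (intro sum.mono_neutral_left) (auto simp: in_keys_iff)

lemma lin_ext_add [simp]: "lin_ext f (x + y) = lin_ext f x + lin_ext f y"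
proof -
  let ?K = "Poly_Mapping.keys x \<union> Poly_Mapping.keys y"
  show ?thesis
    using Poly_Mapping.keys_add[of x y]
    by (simp add: lin_ext_superset[of ?K] lookup_add cscale_add_left sum.distrib)
qed

declare lin_ext_cscale [simp] fun_ext_cscale [simp]

lemma clinear_lin_ext [simp, intro]: "clinear (lin_ext f)"
  by (intro clinearI) auto

lemmas lin_ext_simps [simp] = clinear_simps(3-)[OF clinear_lin_ext]

lemma fun_ext_zero [simp]: "fun_ext f 0 = 0"
  by (simp add: fun_ext_def)

lemma fun_ext_add [simp]: "fun_ext f (x + y) = fun_ext f x + fun_ext f y"
  using fun_ext_sum[of f "\<lambda>b. if b then x else y" UNIV] by (simp add: UNIV_bool add.commute)

lemma cfunctional_fun_ext [simp, intro]: "cfunctional (fun_ext f)"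
  by (simp add: cfunctional_iff)

lemma clinear_id [simp, intro]: "clinear id" "clinear (\<lambda>x. x)"
  by (auto intro: clinearI)

lemma clinear_comp: "clinear f \<Longrightarrow> clinear g \<Longrightarrow> clinear (\<lambda>x. f (g x))"
  by (auto simp: clinear_iff)

lemma lin_ext_plus_fun: "lin_ext (\<lambda>b. f b + g b) x = lin_ext f x + lin_ext g x"
  by (induction x rule: vec_induct) (auto simp: algebra_simps)

lemma lin_ext_scale_fun: "lin_ext (\<lambda>b. c *\<^sub>c f b) x = c *\<^sub>c lin_ext f x"
  by (induction x rule: vec_induct) (auto simp: algebra_simps)

lemma fun_ext_plus_fun: "fun_ext (\<lambda>b. f b + g b) x = fun_ext f x + fun_ext g x"
  by (induction x rule: vec_induct) (auto simp: algebra_simps)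

lemma fun_ext_scale_fun: "fun_ext (\<lambda>b. c * f b) x = c * fun_ext f x"
  by (induction x rule: vec_induct) (auto simp: algebra_simps)

section \<open>Tensor products of vectors and of maps\<close>

lemma tens_add_left [simp]: "(x + y) \<otimes> z = x \<otimes> z + y \<otimes> z"
  and tens_scale_left [simp]: "(c *\<^sub>c x) \<otimes> z = c *\<^sub>c (x \<otimes> z)"
  and tens_add_right [simp]: "x \<otimes> (z + w) = x \<otimes> z + x \<otimes> w"
  and tens_scale_right [simp]: "x \<otimes> (c *\<^sub>c z) = c *\<^sub>c (x \<otimes> z)"
  by (simp_all add: tens_def lin_ext_plus_fun lin_ext_scale_fun)

lemma clinear_tens_left [simp, intro]: "clinear (\<lambda>x. x \<otimes> y)"
  and clinear_tens_right [simp, intro]: "clinear ((\<otimes>) x)"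
  by (auto simp: clinear_iff)

lemmas tens_simps [simp] =
  clinear_simps(3-)[OF clinear_tens_left] clinear_simps(3-)[OF clinear_tens_right]

lemma tens_eqI:
  assumes "clinear f" "clinear g" "\<And>b c. f (bvec b \<otimes> bvec c) = g (bvec b \<otimes> bvec c)"
  shows "f t = g t"
  by (rule clinear_eqI[OF assms(1,2)]) (use assms(3) in auto)

lemma tens_induct [case_names zero add scale tens]:
  assumes "Q 0" "\<And>x y. Q x \<Longrightarrow> Q y \<Longrightarrow> Q (x + y)" "\<And>c x. Q x \<Longrightarrow> Q (c *\<^sub>c x)"
    and "\<And>b c. Q (bvec b \<otimes> bvec c)"
  shows "Q t"
  by (induction t rule: vec_induct) (use assms in auto)

lemma clinear_tmap [simp, intro]: "clinear (tmap f g)"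
  by (simp add: tmap_def)

lemmas tmap_simps [simp] = clinear_simps[OF clinear_tmap]

lemma tmap_tens:
  assumes "clinear f" "clinear g"
  shows "tmap f g (x \<otimes> y) = f x \<otimes> g y"
proof (induction x rule: vec_induct)
  case (basis b)
  show ?case
    by (induction y rule: vec_induct) (simp_all add: clinear_simps[OF assms(1)] clinear_simps[OF assms(2)])
qed (simp_all add: clinear_simps[OF assms(1)] clinear_simps[OF assms(2)])

lemma tmap_id_right: "clinear f \<Longrightarrow> tmap f id (x \<otimes> y) = f x \<otimes> y"
  and tmap_id_left: "clinear f \<Longrightarrow> tmap id f (x \<otimes> y) = x \<otimes> f y"
  by (simp_all add: tmap_tens)

lemma tmap_tmap:
  assumes "clinear f" "clinear g"
  shows "tmap f g (tmap f' g' t) = tmap (\<lambda>x. f (f' x)) (\<lambda>x. g (g' x)) t"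
  by (induction t rule: tens_induct) (simp_all add: tmap_tens assms)

lemma tmap_ident [simp]: "tmap (\<lambda>x. x) (\<lambda>x. x) t = t" "tmap id id t = t"
  by (induction t rule: tens_induct) simp_all

lemma cfunctional_tfun [simp, intro]: "cfunctional (tfun f g)"
  by (simp add: tfun_def)

lemmas tfun_simps [simp] = cfunctional_simps[OF cfunctional_tfun]

lemma tfun_tens:
  assumes "cfunctional f" "cfunctional g"
  shows "tfun f g (x \<otimes> y) = f x * g y"
proof (induction x rule: vec_induct)
  case (basis b)
  show ?case
    by (induction y rule: vec_induct)
      (simp_all add: cfunctional_simps[OF assms(1)] cfunctional_simps[OF assms(2)] tfun_def algebra_simps)
qed (simp_all add: cfunctional_simps[OF assms(1)] cfunctional_simps[OF assms(2)] algebra_simps)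

lemma contract_left:
  assumes "cfunctional e"
  shows "lin_ext (\<lambda>(a, b). e (bvec a) *\<^sub>c bvec b) (x \<otimes> y) = e x *\<^sub>c y"
proof (induction x rule: vec_induct)
  case (basis b)
  show ?case
    by (induction y rule: vec_induct) (simp_all add: mult.commute)
qed (simp_all add: cfunctional_simps[OF assms] cscale_add_left)

lemma contract_right:
  assumes "cfunctional e"
  shows "lin_ext (\<lambda>(a, b). e (bvec b) *\<^sub>c bvec a) (x \<otimes> y) = e y *\<^sub>c x"
proof (induction y rule: vec_induct)
  case (basis b)
  show ?case
    by (induction x rule: vec_induct) (simp_all add: mult.commute)
qed (simp_all add: cfunctional_simps[OF assms] cscale_add_left)

lemma clinear_tassoc [simp, intro]: "clinear tassoc"
  by (simp add: tassoc_def)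

lemmas tassoc_simps [simp] = clinear_simps[OF clinear_tassoc]

lemma tassoc_tens: "tassoc ((x \<otimes> y) \<otimes> z) = x \<otimes> (y \<otimes> z)"
proof (induction x rule: vec_induct)
  case (basis b)
  show ?case
  proof (induction y rule: vec_induct)
    case (basis c)
    show ?case
      by (induction z rule: vec_induct) (simp_all add: tassoc_def)
  qed simp_all
qed simp_all

lemma tassoc_tmap:
  assumes "clinear f" "clinear g" "clinear h"
  shows "tmap f (tmap g h) (tassoc t) = tassoc (tmap (tmap f g) h t)"
proof (induction t rule: tens_induct)
  case (tens b c)
  obtain b1 b2 where b: "bvec b = bvec b1 \<otimes> bvec b2"
    by (metis surj_pair tens_bvec)
  show ?case
    by (simp only: b tassoc_tens tmap_tens[OF clinear_tmap assms(3)] tmap_tens[OF assms(1) clinear_tmap]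
      tmap_tens[OF assms(1,2)] tmap_tens[OF assms(2,3)])
qed simp_all

text \<open>The middle interchange \<open>(a \<otimes> b) \<otimes> (c \<otimes> d) \<mapsto> (a \<otimes> c) \<otimes> (b \<otimes> d)\<close>.\<close>

definition swap_mid :: "(('b \<times> 'c) \<times> ('d \<times> 'e)) vec \<Rightarrow> (('b \<times> 'd) \<times> ('c \<times> 'e)) vec"
  where "swap_mid = lin_ext (\<lambda>((a, b), (c, d)). bvec ((a, c), (b, d)))"

lemma clinear_swap_mid [simp, intro]: "clinear swap_mid"
  by (simp add: swap_mid_def)

lemmas swap_mid_simps [simp] = clinear_simps[OF clinear_swap_mid]

lemma swap_mid_tens: "swap_mid ((w \<otimes> x) \<otimes> (y \<otimes> z)) = (w \<otimes> y) \<otimes> (x \<otimes> z)"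
proof (induction w rule: vec_induct)
  case (basis b)
  show ?case
  proof (induction x rule: vec_induct)
    case (basis c)
    show ?case
    proof (induction y rule: vec_induct)
      case (basis d)
      show ?case
        by (induction z rule: vec_induct) (simp_all, simp add: swap_mid_def)
    qed simp_all
  qed simp_all
qed simp_all

text \<open>A multiplication is passed around as a curried function; the following predicate says
  that it is bilinear.\<close>

definition bilin :: "('b vec \<Rightarrow> 'c vec \<Rightarrow> 'd vec) \<Rightarrow> bool"
  where "bilin m \<longleftrightarrow> (\<forall>y. clinear (\<lambda>x. m x y)) \<and> (\<forall>x. clinear (m x))"

lemma bilinD: "bilin m \<Longrightarrow> clinear (\<lambda>x. m x y)" "bilin m \<Longrightarrow> clinear (m x)"
  by (auto simp: bilin_def)

lemmas bilin_simps = clinear_simps[OF bilinD(1)] clinear_simps[OF bilinD(2)]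

lemma bilin_eqI:
  assumes "bilin m" "bilin m'" "\<And>b c. m (bvec b) (bvec c) = m' (bvec b) (bvec c)"
  shows "m = m'"
proof (intro ext)
  fix x y
  have "m (bvec b) y = m' (bvec b) y" for b
    by (rule clinear_eqI[OF bilinD(2)[OF assms(1)] bilinD(2)[OF assms(2)] assms(3)])
  then show "m x y = m' x y"
    by (rule clinear_eqI[OF bilinD(1)[OF assms(1)] bilinD(1)[OF assms(2)]])
qed

lemma clinear_mult_lin [simp, intro]: "clinear (mult_lin m)"
  by (simp add: mult_lin_def)

lemmas mult_lin_simps [simp] = clinear_simps[OF clinear_mult_lin]

lemma mult_lin_tens:
  assumes "bilin m"
  shows "mult_lin m (x \<otimes> y) = m x y"
proof (induction x rule: vec_induct)
  case (basis b)
  show ?case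
    by (induction y rule: vec_induct) (simp_all add: bilin_simps[OF assms], simp add: mult_lin_def)
qed (simp_all add: bilin_simps[OF assms])

lemma bilin_tmult [simp, intro]: "bilin (tmult m)"
  unfolding bilin_def tmult_def
  by (auto intro!: clinearI simp: split_def lin_ext_plus_fun lin_ext_scale_fun)

lemmas tmult_simps [simp] = bilin_simps[OF bilin_tmult]

lemma tmult_tens:
  assumes "bilin m"
  shows "tmult m (x \<otimes> y) (z \<otimes> w) = m x z \<otimes> m y w"
proof (induction x rule: vec_induct)
  case (basis b)
  show ?case
  proof (induction y rule: vec_induct)
    case (basis c)
    show ?case
    proof (induction z rule: vec_induct)
      case (basis d)
      show ?case
        by (induction w rule: vec_induct) (simp_all add: bilin_simps[OF assms], simp add: tmult_def)
    qed (simp_all add: bilin_simps[OF assms])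
  qed (simp_all add: bilin_simps[OF assms])
qed (simp_all add: bilin_simps[OF assms])

lemma tmult_assoc:
  assumes "bilin m" "\<And>x y z. m (m x y) z = m x (m y z)"
  shows "tmult m (tmult m s t) u = tmult m s (tmult m t u)"
proof (induction s rule: tens_induct)
  case (tens b c)
  show ?case
  proof (induction t rule: tens_induct)
    case (tens b' c')
    show ?case
      by (induction u rule: tens_induct)
        (simp_all only: tmult_simps tmult_tens[OF assms(1)] assms(2))
  qed (simp_all only: tmult_simps)
qed (simp_all only: tmult_simps)

lemma tmult_one:
  assumes "bilin m" "\<And>x. m e x = x"
  shows "tmult m (e \<otimes> e) t = t"
  by (induction t rule: tens_induct) (simp_all only: tmult_simps tmult_tens[OF assms(1)] assms(2))

section \<open>Subspaces of tensor products\<close>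

lemma csubspace_tnull: "csubspace (tnull N M)"
  by (simp add: tnull_def module.subspace_span[OF module_cscale])

lemma tnullI: "x \<in> N \<or> y \<in> M \<Longrightarrow> x \<otimes> y \<in> tnull N M"
  unfolding tnull_def by (rule module.span_base[OF module_cscale]) blast

lemma csubspace_kernel: "clinear f \<Longrightarrow> csubspace {x. f x = 0}"
  by (auto simp: module.subspace_def[OF module_cscale] clinear_simps)

lemma csubspace_vimage:
  assumes "clinear f" "csubspace S"
  shows "csubspace {x. f x \<in> S}"
  using assms(2) by (auto simp: module.subspace_def[OF module_cscale] clinear_simps[OF assms(1)])

lemma tnull_least:
  assumes "csubspace S" "\<And>x y. x \<in> N \<or> y \<in> M \<Longrightarrow> x \<otimes> y \<in> S"
  shows "tnull N M \<subseteq> S"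
  unfolding tnull_def by (rule module.span_minimal[OF module_cscale _ assms(1)]) (use assms(2) in auto)

lemma tnull_trivial [simp]: "tnull {0} {0} = {0}"
proof
  show "tnull {0} {0} \<subseteq> {0}"
    by (rule tnull_least) (auto simp: module.subspace_def[OF module_cscale])
  show "{0} \<subseteq> tnull {0} {0}"
    using module.subspace_0[OF module_cscale csubspace_tnull] by blast
qed

lemma clinear_section:
  assumes "clinear f" "surj f"
  obtains s where "clinear s" "\<And>y. f (s y) = y"
proof
  let ?s = "lin_ext (\<lambda>b. SOME x. f x = bvec b)"
  show "clinear ?s" by simp
  have *: "f (SOME x. f x = bvec b) = bvec b" for b
    by (rule someI_ex) (metis assms(2) surjD)
  show "f (?s y) = y" for y
    by (rule clinear_eqI[OF clinear_comp[OF assms(1)]]) (auto simp: *)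
qed

lemma surj_tmap:
  assumes f: "clinear f" "surj f" and g: "clinear g" "surj g"
  shows "surj (tmap f g)"
proof -
  obtain s where s: "clinear s" "\<And>y. f (s y) = y" using clinear_section[OF f] by metis
  obtain s' where s': "clinear s'" "\<And>y. g (s' y) = y" using clinear_section[OF g] by metis
  have "tmap f g (tmap s s' t) = t" for t
    by (simp add: tmap_tmap f g s s')
  then show ?thesis
    by (metis surjI)
qed

text \<open>For surjections \<open>f\<close> on \<open>V\<close> and \<open>g\<close> on \<open>W\<close> with kernels \<open>N\<close> and \<open>M\<close>, the kernel of \<open>f \<otimes> g\<close> is
  \<open>N \<otimes> W + V \<otimes> M\<close>: with linear sections \<open>s\<close> and \<open>s'\<close>, the difference of \<open>x \<otimes> y\<close> and \<open>s (f x) \<otimes> s' (g y)\<close> lies in that subspace.\<close>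

lemma tnull_kernel:
  assumes f: "clinear f" "surj f" and g: "clinear g" "surj g"
  shows "tnull {x. f x = 0} {y. g y = 0} = {t. tmap f g t = 0}"
proof
  let ?N = "tnull {x. f x = 0} {y. g y = 0}"
  show "?N \<subseteq> {t. tmap f g t = 0}"
    by (rule tnull_least) (auto simp: csubspace_kernel tmap_tens f g)
  obtain s where s: "clinear s" "\<And>y. f (s y) = y" using clinear_section[OF f] by metis
  obtain s' where s': "clinear s'" "\<And>y. g (s' y) = y" using clinear_section[OF g] by metis
  have "t - tmap s s' (tmap f g t) \<in> ?N" for t
  proof (induction t rule: tens_induct)
    case zero
    show ?case by (simp add: module.subspace_0[OF module_cscale csubspace_tnull])
  next
    case (add x y)
    show ?case
      using module.subspace_add[OF module_cscale csubspace_tnull add] by (simp add: algebra_simps)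
  next
    case (scale c x)
    show ?case
      using module.subspace_scale[OF module_cscale csubspace_tnull scale, of c] by simp
  next
    case (tens b c)
    let ?x = "bvec b" and ?y = "bvec c"
    have "(?x - s (f ?x)) \<otimes> ?y + s (f ?x) \<otimes> (?y - s' (g ?y)) \<in> ?N"
      by (intro module.subspace_add[OF module_cscale csubspace_tnull] tnullI)
        (auto simp: clinear_simps[OF f(1)] clinear_simps[OF g(1)] s s')
    also have "(?x - s (f ?x)) \<otimes> ?y + s (f ?x) \<otimes> (?y - s' (g ?y))
        = ?x \<otimes> ?y - tmap s s' (tmap f g (?x \<otimes> ?y))"
      by (simp only: tmap_tens f g s s') (simp del: tens_bvec)
    finally show ?case .
  qed
  then show "{t. tmap f g t = 0} \<subseteq> ?N"
    by (auto dest: spec) (metis diff_zero tmap_simps(3))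
qed

section \<open>The algebra \<open>\<complex>[p, g, g\<^sup>-\<^sup>1]\<close>\<close>

lemma cscale_eq_mult: "c *\<^sub>c x = Poly_Mapping.single 0 c * x"
  for x :: "'b::comm_monoid_add vec"
proof (induction x arbitrary: c rule: vec_induct)
  case (scale d x)
  have "Poly_Mapping.single 0 c * (Poly_Mapping.single 0 d * x) = Poly_Mapping.single 0 (c * d) * x"
    by (simp add: mult_single flip: mult.assoc)
  then show ?case
    by (simp add: scale[of d, symmetric]) (simp add: scale)
next
  case (basis b)
  show ?case
    by (simp add: mult_single) (rule poly_mapping_eqI, simp add: lookup_single when_def)
qed (simp_all add: distrib_left)

lemma cscale_mult_left [simp]: "(c *\<^sub>c x) * y = c *\<^sub>c (x * y)"
  and cscale_mult_right [simp]: "x * (c *\<^sub>c y) = c *\<^sub>c (x * y)"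
  for x y :: "'b::comm_monoid_add vec"
  by (simp_all add: cscale_eq_mult mult_ac)

lemma bvec_mult [simp]: "bvec b * bvec c = bvec (b + c)"
  by (simp add: mult_single)

lemma one_eq_bvec: "(1 :: 'b::zero vec) = bvec 0"
  by (rule poly_mapping_eqI) (simp add: lookup_one lookup_single)

lemma clinear_mult_left [simp, intro]: "clinear ((*) x)"
  and clinear_mult_right [simp, intro]: "clinear (\<lambda>y. y * x)"
  for x :: "'b::comm_monoid_add vec"
  by (auto intro!: clinearI simp: algebra_simps)

lemma tens_mult: "(x \<otimes> y) * (z \<otimes> w) = (x * z) \<otimes> (y * w)"
  for x z :: "'b::comm_monoid_add vec" and y w :: "'c::comm_monoid_add vec"
proof (induction x rule: vec_induct)
  case (basis b)
  show ?case
  proof (induction y rule: vec_induct)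
    case (basis c)
    show ?case
    proof (induction z rule: vec_induct)
      case (basis d)
      show ?case
        by (induction w rule: vec_induct) (simp_all add: algebra_simps)
    qed (simp_all add: algebra_simps)
  qed (simp_all add: algebra_simps)
qed (simp_all add: algebra_simps)

text \<open>The generator \<open>p\<close> and the powers \<open>g\<^sup>r\<close>, with \<^term>\<open>Suc 0\<close> in place of \<open>1\<close> because this is the
  simplifier's normal form of the exponent.\<close>

abbreviation pvec :: "(nat \<times> int) vec"
  where "pvec \<equiv> bvec (Suc 0, 0)"

abbreviation gvec :: "int \<Rightarrow> (nat \<times> int) vec"
  where "gvec r \<equiv> bvec (0, r)"

lemma gvec_0 [simp]: "gvec 0 = 1"
  by (simp del: single_one add: one_eq_bvec zero_prod_def)

lemma pvec_power: "pvec ^ n = bvec (n, 0)"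
  by (induction n) simp_all

lemma bvec_monomial: "bvec (n, r) = pvec ^ n * gvec r"
  by (simp add: pvec_power)

text \<open>Unital algebra homomorphisms between the monoid algebras of commutative monoids.\<close>

definition alg_hom :: "('b::comm_monoid_add vec \<Rightarrow> 'c::comm_monoid_add vec) \<Rightarrow> bool"
  where "alg_hom f \<longleftrightarrow> clinear f \<and> f 1 = 1 \<and> (\<forall>x y. f (x * y) = f x * f y)"

lemma alg_homD:
  "alg_hom f \<Longrightarrow> clinear f" "alg_hom f \<Longrightarrow> f 1 = 1" "alg_hom f \<Longrightarrow> f (x * y) = f x * f y"
  by (auto simp: alg_hom_def)

lemma alg_homI:
  assumes "clinear f" "f 1 = 1" "\<And>b c. f (bvec b * bvec c) = f (bvec b) * f (bvec c)"
  shows "alg_hom f"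
proof -
  have "f (bvec b * y) = f (bvec b) * f y" for b y
    by (induction y rule: vec_induct)
      (use assms(3) in \<open>auto simp: clinear_simps[OF assms(1)] distrib_left\<close>)
  then have "f (x * y) = f x * f y" for x y
    by (induction x rule: vec_induct) (auto simp: clinear_simps[OF assms(1)] distrib_right)
  then show ?thesis
    using assms by (simp add: alg_hom_def)
qed

lemma alg_hom_comp: "alg_hom f \<Longrightarrow> alg_hom g \<Longrightarrow> alg_hom (\<lambda>x. f (g x))"
  by (auto simp: alg_hom_def clinear_comp)

lemma alg_hom_id: "alg_hom id"
  by (simp add: alg_hom_def)

lemma alg_hom_power: "alg_hom f \<Longrightarrow> f (x ^ n) = f x ^ n"
  by (induction n) (auto simp: alg_hom_def)

lemma alg_hom_eqI:
  assumes "alg_hom f" "alg_hom h" "f pvec = h pvec" "\<And>r. f (gvec r) = h (gvec r)"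
  shows "f x = h x"
proof (rule clinear_eqI[OF alg_homD(1)[OF assms(1)] alg_homD(1)[OF assms(2)]])
  fix b :: "nat \<times> int"
  obtain n r where b: "bvec b = pvec ^ n * gvec r"
    by (metis bvec_monomial surj_pair)
  show "f (bvec b) = h (bvec b)"
    by (simp only: b alg_homD(3)[OF assms(1)] alg_homD(3)[OF assms(2)]
      alg_hom_power[OF assms(1)] alg_hom_power[OF assms(2)] assms(3,4))
qed

lemma one_tens_one: "1 \<otimes> 1 = (1 :: ('b::comm_monoid_add \<times> 'c::comm_monoid_add) vec)"
  by (simp del: single_one add: one_eq_bvec zero_prod_def)

lemma alg_hom_tmap:
  assumes "alg_hom f" "alg_hom g"
  shows "alg_hom (tmap f g)"
proof (rule alg_homI)
  have "tmap f g (1 \<otimes> 1) = 1 \<otimes> 1"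
    by (simp only: tmap_tens[OF alg_homD(1)[OF assms(1)] alg_homD(1)[OF assms(2)]]
      alg_homD(2)[OF assms(1)] alg_homD(2)[OF assms(2)])
  then show "tmap f g 1 = 1"
    by (simp only: one_tens_one)
  fix b c :: "'a \<times> 'c"
  show "tmap f g (bvec b * bvec c) = tmap f g (bvec b) * tmap f g (bvec c)"
    by (cases b; cases c) (simp add: tens_mult flip: alg_homD(3)[OF assms(1)] alg_homD(3)[OF assms(2)])
qed simp

lemma alg_hom_tassoc: "alg_hom tassoc"
  by (rule alg_homI) (auto simp del: single_one simp: tassoc_def one_eq_bvec zero_prod_def)

section \<open>The coalgebra of \<open>C(B\<^sub>+)\<close>\<close>

lemma CB_simps [simp]: "null CB = {0}" "mult CB = (*)" "unit CB = 1"
  by (simp_all add: CB_def)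

abbreviation Delta :: "(nat \<times> int) vec \<Rightarrow> ((nat \<times> int) \<times> (nat \<times> int)) vec"
  where "Delta \<equiv> comult CB"

text \<open>The element \<open>\<Delta> p\<close> of the tensor square (see \<open>Delta_pvec\<close> below).\<close>

abbreviation Delta_p :: "((nat \<times> int) \<times> (nat \<times> int)) vec"
  where "Delta_p \<equiv> pvec \<otimes> gvec 1 + gvec 0 \<otimes> pvec"

abbreviation eps :: "(nat \<times> int) vec \<Rightarrow> complex"
  where "eps \<equiv> counit CB"

lemma clinear_Delta [simp, intro]: "clinear Delta"
  by (simp add: CB_def)

lemmas Delta_simps [simp] = clinear_simps[OF clinear_Delta]

lemma cfunctional_eps [simp, intro]: "cfunctional eps"
  by (simp add: CB_def)

lemmas eps_simps [simp] = cfunctional_simps[OF cfunctional_eps]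

lemma eps_bvec: "eps (bvec (n, r)) = (if n = 0 then 1 else 0)"
  by (simp add: CB_def)

lemma Delta_bvec: "Delta (bvec (n, r)) = Delta_p ^ n * (gvec r \<otimes> gvec r)"
  by (simp add: CB_def)

lemma Delta_gvec: "Delta (gvec r) = gvec r \<otimes> gvec r"
  by (simp only: Delta_bvec power_0 mult_1)

lemma alg_hom_Delta: "alg_hom Delta"
proof (rule alg_homI)
  show "Delta 1 = 1"
    using Delta_gvec[of 0] by (simp only: gvec_0 one_tens_one)
  fix b c :: "nat \<times> int"
  have "Delta_p ^ (m + n) * (gvec (r + s) \<otimes> gvec (r + s))
      = (Delta_p ^ m * (gvec r \<otimes> gvec r)) * (Delta_p ^ n * (gvec s \<otimes> gvec s))" for m n r s
  proof -
    have "gvec (r + s) \<otimes> gvec (r + s) = (gvec r \<otimes> gvec r) * (gvec s \<otimes> gvec s)"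
      by (simp add: tens_mult)
    then show ?thesis
      by (simp only: power_add mult_ac)
  qed
  then show "Delta (bvec b * bvec c) = Delta (bvec b) * Delta (bvec c)"
    by (cases b; cases c) (simp only: Delta_bvec bvec_mult add_Pair)
qed simp

lemma Delta_pvec: "Delta pvec = Delta_p"
  by (simp only: Delta_bvec power_one_right) (simp add: one_tens_one)

lemma Delta_coassoc: "tassoc (tmap Delta id (Delta x)) = tmap id Delta (Delta x)"
proof (rule alg_hom_eqI[where f = "\<lambda>x. tassoc (tmap Delta id (Delta x))"])
  show "alg_hom (\<lambda>x. tassoc (tmap Delta id (Delta x)))" "alg_hom (\<lambda>x. tmap id Delta (Delta x))"
    by (intro alg_hom_comp[OF alg_hom_tassoc] alg_hom_comp[OF alg_hom_tmap] alg_hom_Delta alg_hom_id)+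
qed (simp_all only: Delta_pvec Delta_gvec tmap_simps tassoc_simps
      tmap_tens[OF clinear_Delta clinear_id(1)] tmap_tens[OF clinear_id(1) clinear_Delta]
      tmap_tens[OF clinear_Delta clinear_id(2)] tmap_tens[OF clinear_id(2) clinear_Delta]
      tens_add_left tens_add_right tassoc_tens id_apply add.assoc)

lemma eps_mult: "eps (x * y) = eps x * eps y"
proof (induction x rule: vec_induct)
  case (basis b)
  show ?case
    by (induction y rule: vec_induct; cases b) (auto simp: eps_bvec distrib_left)
qed (simp_all add: distrib_right)

lemma eps_1 [simp]: "eps 1 = 1"
  using eps_bvec[of 0 0] by simp

lemma Delta_counit_left: "lin_ext (\<lambda>(a, b). eps (bvec a) *\<^sub>c bvec b) (Delta x) = x"
  and Delta_counit_right: "lin_ext (\<lambda>(a, b). eps (bvec b) *\<^sub>c bvec a) (Delta x) = x"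
proof -
  let ?f = "lin_ext (\<lambda>(a, b). eps (bvec a) *\<^sub>c bvec b)"
    and ?g = "lin_ext (\<lambda>(a, b). eps (bvec b) *\<^sub>c bvec a)"
  have eps_add: "eps (bvec (a + b)) = eps (bvec a) * eps (bvec b)" for a b
    by (simp flip: eps_mult)
  have hom: "alg_hom ?f" "alg_hom ?g"
    by (rule alg_homI; auto simp del: single_one gvec_0 simp: one_eq_bvec zero_prod_def eps_bvec eps_add)+
  show "?f (Delta x) = x"
    by (rule alg_hom_eqI[OF alg_hom_comp[OF hom(1) alg_hom_Delta] alg_hom_id, unfolded id_apply])
      (simp_all add: Delta_pvec Delta_gvec eps_bvec del: gvec_0)
  show "?g (Delta x) = x"
    by (rule alg_hom_eqI[OF alg_hom_comp[OF hom(2) alg_hom_Delta] alg_hom_id, unfolded id_apply])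
      (simp_all add: Delta_pvec Delta_gvec eps_bvec del: gvec_0)
qed

section \<open>The deformed algebra\<close>

text \<open>The operator \<open>X = p + a (p \<partial>\<^sub>p + (g - g\<^sup>2) \<partial>\<^sub>g)\<close>, on monomials. The derivation in brackets
  satisfies \<open>p \<mapsto> p\<close> and \<open>g \<mapsto> g - g\<^sup>2\<close>, which gives the two commutation rules
  \<open>left_p_mult_pvec\<close> and \<open>left_p_mult_gvec\<close>.\<close>

definition left_p :: "complex \<Rightarrow> (nat \<times> int) vec \<Rightarrow> (nat \<times> int) vec"
  where "left_p a = lin_ext (\<lambda>(n, r). bvec (Suc n, r)
    + (a * (of_nat n + of_int r)) *\<^sub>c bvec (n, r) - (a * of_int r) *\<^sub>c bvec (n, r + 1))"

text \<open>The operator \<open>X (X - a) \<cdots> (X - (n - 1) a)\<close>, which is left multiplication by the monomial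
  \<open>p\<^sup>n\<close>. It is not the \<open>n\<close>-th power of \<open>X\<close>, since \<open>p\<^sup>n\<close> is not the \<open>n\<close>-th deformed power of \<open>p\<close>:
  for example, the deformed square of \<open>p\<close> is \<open>p\<^sup>2 + a p\<close>.\<close>

primrec left_pn :: "complex \<Rightarrow> nat \<Rightarrow> (nat \<times> int) vec \<Rightarrow> (nat \<times> int) vec"
  where
    "left_pn a 0 y = y"
  | "left_pn a (Suc n) y = left_p a (left_pn a n y) - (a * of_nat n) *\<^sub>c left_pn a n y"

text \<open>The deformed product. The factor \<open>g\<^sup>r\<close> acts after \<open>p\<^sup>n\<close>, so the monomial \<open>p\<^sup>n g\<^sup>r\<close> is the
  deformed product of \<open>g\<^sup>r\<close> and \<open>p\<^sup>n\<close> in this order.\<close>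

definition dmult :: "complex \<Rightarrow> (nat \<times> int) vec \<Rightarrow> (nat \<times> int) vec \<Rightarrow> (nat \<times> int) vec"
  where "dmult a x y = lin_ext (\<lambda>(n, r). gvec r * left_pn a n y) x"

lemma clinear_left_p [simp, intro]: "clinear (left_p a)"
  by (simp add: left_p_def)

lemmas left_p_simps [simp] = clinear_simps[OF clinear_left_p]

lemma left_p_bvec: "left_p a (bvec (n, r)) = bvec (Suc n, r)
    + (a * (of_nat n + of_int r)) *\<^sub>c bvec (n, r) - (a * of_int r) *\<^sub>c bvec (n, r + 1)"
  by (simp add: left_p_def)

lemma left_p_gvec: "left_p a (gvec r) =
    bvec (Suc 0, r) + (a * of_int r) *\<^sub>c gvec r - (a * of_int r) *\<^sub>c gvec (r + 1)"
  using left_p_bvec[of a 0 r] by simp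

lemma left_p_one [simp]: "left_p a 1 = pvec"
  using left_p_gvec[of a 0] by simp

lemma left_p_mult_pvec: "left_p a (pvec * y) = pvec * left_p a y + a *\<^sub>c (pvec * y)"
proof (induction y rule: vec_induct)
  case (basis b)
  show ?case
    by (cases b) (simp add: left_p_bvec algebra_simps cscale_add_left)
qed (simp_all add: algebra_simps)

lemma left_p_mult_gvec: "left_p a (gvec r * y) =
    gvec r * left_p a y + (a * of_int r) *\<^sub>c (gvec r * y) - (a * of_int r) *\<^sub>c (gvec (r + 1) * y)"
proof (induction y rule: vec_induct)
  case (basis b)
  show ?case
    by (cases b) (simp add: left_p_bvec algebra_simps cscale_add_left)
next
  case (scale c y)
  then show ?case
    by (simp only: cscale_mult_right left_p_simps cscale_add_right cscale_diff_right cscale_cscale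
      mult.commute[of c])
qed (simp_all add: algebra_simps)

lemma clinear_left_pn [simp, intro]: "clinear (left_pn a n)"
  by (induction n) (auto simp: clinear_iff algebra_simps)

lemma bilin_dmult [simp, intro]: "bilin (dmult a)"
proof -
  have "dmult a x (y + z) = dmult a x y + dmult a x z"
    "dmult a x (c *\<^sub>c y) = c *\<^sub>c dmult a x y" for x y z c
    by (induction x rule: vec_induct)
      (auto simp: dmult_def clinear_simps[OF clinear_left_pn] algebra_simps split: prod.splits)
  then show ?thesis
    by (auto simp: bilin_def clinear_iff) (auto simp: dmult_def)
qed

lemmas dmult_simps [simp] = bilin_simps[OF bilin_dmult]

lemma dmult_bvec: "dmult a (bvec (n, r)) y = gvec r * left_pn a n y"
  by (simp add: dmult_def)

lemma dmult_gvec_mult: "dmult a (gvec r * x) y = gvec r * dmult a x y"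
proof (induction x rule: vec_induct)
  case (basis b)
  show ?case
    by (cases b) (simp add: dmult_bvec flip: mult.assoc)
qed (simp_all add: distrib_left)

lemma dmult_left_p: "dmult a (left_p a x) y = left_p a (dmult a x y)"
proof (induction x rule: vec_induct)
  case (basis b)
  show ?case
    by (cases b) (simp add: left_p_bvec dmult_bvec left_p_mult_gvec cscale_add_left distrib_left right_diff_distrib)
qed simp_all

lemma dmult_one_left [simp]: "dmult a 1 y = y"
  using dmult_bvec[of a 0 0 y] by simp

lemma dmult_gvec [simp]: "dmult a (gvec r) y = gvec r * y"
  using dmult_gvec_mult[of a r 1 y] by simp

lemma dmult_pvec [simp]: "dmult a pvec y = left_p a y"
  using dmult_left_p[of a 1 y] by simp

lemma left_pn_one: "left_pn a n 1 = bvec (n, 0)"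
  by (induction n) (simp_all add: left_p_bvec)

lemma dmult_one_right [simp]: "dmult a x 1 = x"
proof (induction x rule: vec_induct)
  case (basis b)
  show ?case
    by (cases b) (simp add: dmult_bvec left_pn_one)
qed simp_all

text \<open>The unit, multiplication by powers of \<open>g\<close> and left multiplication by \<open>p\<close> generate everything.\<close>

lemma gen_induct [case_names zero add scale one gvec p]:
  assumes "Q 0" "\<And>x y. Q x \<Longrightarrow> Q y \<Longrightarrow> Q (x + y)" "\<And>c x. Q x \<Longrightarrow> Q (c *\<^sub>c x)"
    and one: "Q 1" and gvec: "\<And>r x. Q x \<Longrightarrow> Q (gvec r * x)" and p: "\<And>x. Q x \<Longrightarrow> Q (left_p a x)"
  shows "Q x"
proof (induction x rule: vec_induct)
  case (basis b)
  have pn: "Q (bvec (n, 0))" for n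
  proof (induction n)
    case (Suc n)
    have "Q (left_p a (bvec (n, 0)) + (- (a * of_nat n)) *\<^sub>c bvec (n, 0))"
      using Suc by (intro assms)
    then show ?case
      by (simp add: left_p_bvec)
  qed (simp add: one)
  obtain n r where b: "b = (n, r)"
    by (cases b)
  show ?case
    using gvec[OF pn[of n], of r] by (simp add: b)
qed (auto intro: assms)

lemma dmult_assoc: "dmult a (dmult a x y) z = dmult a x (dmult a y z)"
  by (induction x rule: gen_induct[where a = a]) (simp_all add: dmult_gvec_mult dmult_left_p)

lemma left_p_0: "left_p 0 y = pvec * y"
proof (induction y rule: vec_induct)
  case (basis b)
  show ?case
    by (cases b) (simp add: left_p_bvec)
qed (simp_all add: algebra_simps)

lemma dmult_0: "dmult 0 = (*)"
proof -
  have "dmult 0 x y = x * y" for x y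
  proof (induction x rule: gen_induct[where a = 0])
    case (p x)
    then show ?case
      by (simp only: dmult_left_p) (simp only: left_p_0 mult.assoc)
  qed (simp_all add: dmult_gvec_mult distrib_right mult.assoc)
  then show ?thesis by blast
qed

section \<open>The deformed Hopf algebra\<close>

text \<open>The action \<open>X \<otimes> g + 1 \<otimes> X\<close> of \<open>\<Delta> p\<close> on the tensor square.\<close>

definition left_p2 :: "complex \<Rightarrow> ((nat \<times> int) \<times> (nat \<times> int)) vec \<Rightarrow> ((nat \<times> int) \<times> (nat \<times> int)) vec"
  where "left_p2 a t = tmap (left_p a) ((*) (gvec 1)) t + tmap (\<lambda>x. x) (left_p a) t"

lemma clinear_left_p2 [simp, intro]: "clinear (left_p2 a)"
  by (auto intro: clinearI simp: left_p2_def)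

lemmas left_p2_simps [simp] = clinear_simps[OF clinear_left_p2]

lemma left_p2_tens: "left_p2 a (x \<otimes> y) = left_p a x \<otimes> (gvec 1 * y) + x \<otimes> left_p a y"
  by (simp only: left_p2_def tmap_tens clinear_left_p clinear_mult_left clinear_id)

lemma Delta_p_tens: "Delta_p * (x \<otimes> y) = (pvec * x) \<otimes> (gvec 1 * y) + x \<otimes> (pvec * y)"
  by (simp only: distrib_right tens_mult gvec_0 mult_1_left)

lemma left_p2_mult_Delta_p: "left_p2 a (Delta_p * t) = Delta_p * left_p2 a t + a *\<^sub>c (Delta_p * t)"
proof (rule tens_eqI[where f = "\<lambda>t. left_p2 a (Delta_p * t)"])
  have "clinear (\<lambda>t. left_p2 a (q * t))" "clinear (\<lambda>t. q * left_p2 a t + a *\<^sub>c (q * t))" for q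
    by (auto intro!: clinearI simp: algebra_simps)
  then show "clinear (\<lambda>t. left_p2 a (Delta_p * t))"
    "clinear (\<lambda>t. Delta_p * left_p2 a t + a *\<^sub>c (Delta_p * t))"
    by blast+
  have "left_p2 a (Delta_p * (x \<otimes> y)) = Delta_p * left_p2 a (x \<otimes> y) + a *\<^sub>c (Delta_p * (x \<otimes> y))" for x y
    by (simp only: Delta_p_tens left_p2_tens left_p2_simps distrib_left left_p_mult_pvec
        left_p_mult_gvec tens_add_left tens_add_right tens_simps tens_scale_left tens_scale_right)
      (simp add: algebra_simps)
  then show "left_p2 a (Delta_p * (bvec b \<otimes> bvec c)) =
      Delta_p * left_p2 a (bvec b \<otimes> bvec c) + a *\<^sub>c (Delta_p * (bvec b \<otimes> bvec c))" for b c .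
qed

text \<open>By induction on the power of \<open>p\<close>: both sides have the same commutator with multiplication
  by \<open>p\<close>, respectively by \<open>\<Delta> p\<close>, and they agree on \<open>g\<^sup>r\<close>.\<close>

lemma Delta_left_p: "Delta (left_p a y) = left_p2 a (Delta y)"
proof (induction y rule: vec_induct)
  case (basis b)
  obtain n r where b: "b = (n, r)"
    by (cases b)
  have "Delta (left_p a (bvec (n, r))) = left_p2 a (Delta (bvec (n, r)))"
  proof (induction n)
    case 0
    have "Delta (bvec (Suc 0, r)) = Delta_p * (gvec r \<otimes> gvec r)"
      by (simp only: Delta_bvec power_one_right power_Suc power_0 mult_1_right)
    then show ?case
      by (simp only: left_p_gvec Delta_gvec Delta_simps left_p2_tens Delta_p_tens)
        (simp add: algebra_simps)
  next
    case (Suc n)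
    have "bvec (Suc n, r) = pvec * bvec (n, r)"
      by simp
    then show ?case
      by (simp only: left_p_mult_pvec alg_homD(3)[OF alg_hom_Delta] Delta_simps Suc Delta_pvec
        left_p2_mult_Delta_p)
  qed
  then show ?case
    by (simp add: b)
qed simp_all

lemma tmult_Delta_p: "tmult (dmult a) Delta_p t = left_p2 a t"
  by (induction t rule: tens_induct)
    (simp_all only: tmult_simps left_p2_simps tmult_tens[OF bilin_dmult] left_p2_tens
      dmult_pvec dmult_gvec gvec_0 dmult_one_left)

lemma tmult_gvec: "tmult (dmult a) (gvec r \<otimes> gvec s) t = (gvec r \<otimes> gvec s) * t"
proof (induction t rule: tens_induct)
  case (tens b c)
  show ?case
    by (simp only: tmult_tens[OF bilin_dmult] dmult_gvec tens_mult)
qed (simp_all add: distrib_left)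

lemma Delta_one: "Delta 1 = 1 \<otimes> 1"
  using Delta_gvec[of 0] by (simp only: gvec_0)

lemma Delta_dmult: "Delta (dmult a x y) = tmult (dmult a) (Delta x) (Delta y)"
proof (induction x rule: gen_induct[where a = a])
  case one
  show ?case
    by (simp only: dmult_one_left Delta_one tmult_one[OF bilin_dmult dmult_one_left])
next
  case (gvec r x)
  then show ?case
    by (simp only: dmult_gvec_mult alg_homD(3)[OF alg_hom_Delta] Delta_gvec
        tmult_assoc[OF bilin_dmult dmult_assoc] flip: tmult_gvec[where a = a])
next
  case (p x)
  then show ?case
    by (simp only: dmult_left_p Delta_left_p tmult_assoc[OF bilin_dmult dmult_assoc]
      flip: tmult_Delta_p)
qed simp_all

lemma eps_left_p [simp]: "eps (left_p a y) = 0"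
proof (induction y rule: vec_induct)
  case (basis b)
  show ?case
    by (cases b) (simp only: left_p_bvec diff_conv_add_uminus eps_simps eps_bvec flip: cscale_minus_left,
      auto)
qed simp_all

lemma eps_gvec_mult [simp]: "eps (gvec r * y) = eps y"
  by (simp add: eps_mult eps_bvec)

lemma eps_dmult: "eps (dmult a x y) = eps x * eps y"
  by (induction x rule: gen_induct[where a = a])
    (simp_all add: dmult_gvec_mult dmult_left_p distrib_right)

text \<open>The antipode of \<open>p\<^sup>n g\<^sup>r\<close> in the deformed algebra. Since the deformed product of \<open>p\<^sup>n g\<^sup>r\<close>
  and \<open>p\<close> is \<open>p\<^sup>n\<^sup>+\<^sup>1 g\<^sup>r + n a p\<^sup>n g\<^sup>r\<close>, and left multiplication by \<open>S p\<close> is \<open>- X g\<^sup>-\<^sup>1\<close>, the recursion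
  says that \<open>S (y p) = S p S y\<close> for monomials \<open>y\<close>.\<close>

primrec antipode_mon :: "complex \<Rightarrow> nat \<Rightarrow> int \<Rightarrow> (nat \<times> int) vec"
  where
    "antipode_mon a 0 r = gvec (- r)"
  | "antipode_mon a (Suc n) r =
      - left_p a (gvec (- 1) * antipode_mon a n r) - (a * of_nat n) *\<^sub>c antipode_mon a n r"

definition dantipode :: "complex \<Rightarrow> (nat \<times> int) vec \<Rightarrow> (nat \<times> int) vec"
  where "dantipode a = lin_ext (\<lambda>(n, r). antipode_mon a n r)"

lemma clinear_dantipode [simp, intro]: "clinear (dantipode a)"
  by (simp add: dantipode_def)

lemmas dantipode_simps [simp] = clinear_simps[OF clinear_dantipode]

lemma dantipode_bvec: "dantipode a (bvec (n, r)) = antipode_mon a n r"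
  by (simp add: dantipode_def)

text \<open>The deformed antipode of \<open>p\<close>, namely minus the deformed product of \<open>p\<close> and \<open>g\<^sup>-\<^sup>1\<close>.\<close>

definition Sp :: "complex \<Rightarrow> (nat \<times> int) vec"
  where "Sp a = - left_p a (gvec (- 1))"

lemma dmult_Sp: "dmult a (Sp a) y = - left_p a (gvec (- 1) * y)"
  by (simp add: Sp_def dmult_left_p)

lemma antipode_mon_Suc:
  "antipode_mon a (Suc n) r = dmult a (Sp a) (antipode_mon a n r) - (a * of_nat n) *\<^sub>c antipode_mon a n r"
  by (simp only: dmult_Sp antipode_mon.simps)

lemma antipode_mon_add: "antipode_mon a n (r + s) = dmult a (antipode_mon a n r) (gvec (- s))"
proof (induction n)
  case (Suc n)
  then show ?case
    by (simp only: antipode_mon_Suc dmult_simps dmult_assoc)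
qed simp

lemma dantipode_gvec_mult: "dantipode a (gvec r * y) = dmult a (dantipode a y) (gvec (- r))"
proof (induction y rule: vec_induct)
  case (basis b)
  obtain n s where b: "b = (n, s)"
    by (cases b)
  show ?case
    using antipode_mon_add[of a n s r] by (simp add: b dantipode_bvec add.commute)
qed (simp_all add: distrib_left)

lemma antipode_mon_commute: "dmult a (Sp a) (antipode_mon a n 0) = dmult a (antipode_mon a n 0) (Sp a)"
proof (induction n)
  case 0
  show ?case by simp
next
  case (Suc n)
  then show ?case
    by (simp only: antipode_mon_Suc dmult_simps flip: dmult_assoc)
qed

lemma Sp_gvec: "dmult a (Sp a) (gvec (- r)) + (a * of_int r) *\<^sub>c gvec (- r) - (a * of_int r) *\<^sub>c gvec (- r - 1)
    = gvec (- r) * Sp a"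
proof -
  have "- r - 1 = - 1 - r"
    by simp
  then show ?thesis
    by (simp only: dmult_Sp)
      (simp add: Sp_def left_p_gvec algebra_simps cscale_add_left cscale_diff_left)
qed

text \<open>The defining recursion multiplies by \<open>S p\<close> on the left. Here it is moved to the right: it
  commutes with \<open>S (p\<^sup>n)\<close>, which is a polynomial in \<open>S p\<close>, and its commutator with powers of \<open>g\<close>
  is given by \<open>Sp_gvec\<close>.\<close>

lemma dantipode_left_p: "dantipode a (left_p a y) = dmult a (dantipode a y) (Sp a)"
proof (induction y rule: vec_induct)
  case (basis b)
  obtain n r where b: "b = (n, r)"
    by (cases b)
  let ?s = "antipode_mon a n 0"
  have shift: "antipode_mon a m r = dmult a (antipode_mon a m 0) (gvec (- r))"
    "antipode_mon a m (r + 1) = dmult a (antipode_mon a m 0) (gvec (- r - 1))" for m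
    using antipode_mon_add[of a m 0 r] antipode_mon_add[of a m 0 "r + 1"] by simp_all
  have "dantipode a (left_p a (bvec b)) = antipode_mon a (Suc n) r
      + (a * (of_nat n + of_int r)) *\<^sub>c antipode_mon a n r - (a * of_int r) *\<^sub>c antipode_mon a n (r + 1)"
    by (simp only: b left_p_bvec dantipode_simps dantipode_bvec)
  also have "\<dots> = dmult a (antipode_mon a (Suc n) 0 + (a * of_nat n) *\<^sub>c ?s) (gvec (- r))
      + (a * of_int r) *\<^sub>c dmult a ?s (gvec (- r)) - (a * of_int r) *\<^sub>c dmult a ?s (gvec (- r - 1))"
    unfolding shift by (simp add: algebra_simps cscale_add_left)
  also have "antipode_mon a (Suc n) 0 + (a * of_nat n) *\<^sub>c ?s = dmult a ?s (Sp a)"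
    by (simp only: antipode_mon_Suc antipode_mon_commute diff_add_cancel)
  also have "dmult a (dmult a ?s (Sp a)) (gvec (- r)) + (a * of_int r) *\<^sub>c dmult a ?s (gvec (- r))
      - (a * of_int r) *\<^sub>c dmult a ?s (gvec (- r - 1)) = dmult a ?s (gvec (- r) * Sp a)"
    by (simp only: dmult_assoc dmult_simps flip: Sp_gvec)
  also have "\<dots> = dmult a (dantipode a (bvec b)) (Sp a)"
    by (simp only: b dantipode_bvec shift(1)[of n] dmult_assoc dmult_gvec)
  finally show ?case .
qed simp_all

lemma dantipode_one [simp]: "dantipode a 1 = 1"
  using dantipode_bvec[of a 0 0] by simp

lemma dantipode_dmult: "dantipode a (dmult a x y) = dmult a (dantipode a y) (dantipode a x)"
  by (induction x rule: gen_induct[where a = a])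
    (simp_all only: dmult_simps dantipode_simps dmult_one_left dmult_one_right dantipode_one
      dmult_gvec_mult dmult_left_p dantipode_gvec_mult dantipode_left_p dmult_assoc)

lemma gvec_mult_cancel: "gvec r * (gvec (- r) * y) = y" "gvec (- r) * (gvec r * y) = y"
  by (simp_all flip: mult.assoc)

lemma dantipode_left: "mult_lin (dmult a) (tmap (dantipode a) id (Delta x)) = eps x *\<^sub>c 1"
proof -
  let ?f = "\<lambda>t. mult_lin (dmult a) (tmap (dantipode a) id t)"
  have f_tens: "?f (x \<otimes> y) = dmult a (dantipode a x) y" for x y
    by (simp add: tmap_tens mult_lin_tens)
  have g: "?f ((gvec r \<otimes> gvec r) * t) = ?f t" for r t
  proof (induction t rule: tens_induct)
    case (tens b c)
    show ?case
      by (simp only: tens_mult f_tens dantipode_gvec_mult dmult_assoc dmult_gvec gvec_mult_cancel)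
  qed (simp_all add: distrib_left)
  have p: "?f (left_p2 a t) = 0" for t
  proof (induction t rule: tens_induct)
    case (tens b c)
    show ?case
      by (simp only: left_p2_tens tmap_simps mult_lin_simps f_tens dantipode_left_p dmult_assoc
        dmult_Sp gvec_mult_cancel) simp
  qed simp_all
  show ?thesis
  proof (induction x rule: gen_induct[where a = a])
    case one
    show ?case
      by (simp only: Delta_one f_tens dmult_one_left dantipode_one eps_1 cscale_1)
  next
    case (gvec r x)
    then show ?case
      by (simp only: alg_homD(3)[OF alg_hom_Delta] Delta_gvec g eps_gvec_mult)
  next
    case (p x)
    show ?case
      by (simp only: Delta_left_p \<open>?f (left_p2 a _) = 0\<close> eps_left_p cscale_0)
  qed (simp_all add: cscale_add_left)
qed

lemma dantipode_right: "mult_lin (dmult a) (tmap id (dantipode a) (Delta x)) = eps x *\<^sub>c 1"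
proof -
  let ?f = "\<lambda>t. mult_lin (dmult a) (tmap id (dantipode a) t)"
  have f_tens: "?f (x \<otimes> y) = dmult a x (dantipode a y)" for x y
    by (simp add: tmap_tens mult_lin_tens)
  have g: "?f ((gvec r \<otimes> gvec r) * t) = gvec r * dmult a (?f t) (gvec (- r))" for r t
  proof (induction t rule: tens_induct)
    case (tens b c)
    show ?case
      by (simp only: tens_mult f_tens dantipode_gvec_mult dmult_assoc dmult_gvec_mult)
  qed (simp_all add: distrib_left)
  have p: "?f (left_p2 a t) = dmult a (left_p a (?f t)) (gvec (- 1)) + dmult a (?f t) (Sp a)" for t
  proof (induction t rule: tens_induct)
    case (tens b c)
    show ?case
      by (simp only: left_p2_tens tmap_simps mult_lin_simps f_tens dantipode_left_p dantipode_gvec_mult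
        dmult_assoc dmult_left_p)
  qed simp_all
  show ?thesis
  proof (induction x rule: gen_induct[where a = a])
    case one
    show ?case
      by (simp only: Delta_one f_tens dmult_one_left dantipode_one eps_1 cscale_1)
  next
    case (gvec r x)
    then show ?case
      by (simp only: alg_homD(3)[OF alg_hom_Delta] Delta_gvec g eps_gvec_mult) simp
  next
    case (p x)
    then show ?case
      by (simp only: Delta_left_p \<open>\<And>t. ?f (left_p2 a t) = _ t\<close> eps_left_p) (simp add: Sp_def)
  qed (simp_all add: cscale_add_left)
qed

text \<open>The deformation of \<open>C(B\<^sub>+)\<close> that serves as a common model of the cocycle twist and of the
  Planck scale Hopf algebra.\<close>

definition planck_model :: "complex \<Rightarrow> (nat \<times> int) hopf"
  where "planck_model a = CB\<lparr>mult := dmult a, antipode := dantipode a\<rparr>"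

lemma planck_model_simps [simp]:
  "null (planck_model a) = {0}" "mult (planck_model a) = dmult a" "unit (planck_model a) = 1"
  "comult (planck_model a) = Delta" "counit (planck_model a) = eps"
  "antipode (planck_model a) = dantipode a"
  by (simp_all add: planck_model_def)

lemma hopf_algebra_planck_model: "hopf_algebra (planck_model a)"
  by (rule hopf_algebra.intro)
    (simp_all del: id_apply add: module.subspace_def[OF module_cscale] bilinD dmult_assoc Delta_coassoc
      Delta_counit_left Delta_counit_right Delta_dmult eps_dmult dantipode_left dantipode_right
      Delta_one)

lemma planck_model_0: "planck_model 0 = CB"
proof -
  have "antipode_mon 0 n r = (- bvec (1, - 1)) ^ n * bvec (0, - r)" for n r
    by (induction n) (simp_all add: left_p_0 mult.assoc[symmetric])
  then show ?thesis
    by (simp add: planck_model_def dmult_0 dantipode_def CB_def)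
qed

section \<open>Exponentials of locally nilpotent operators\<close>

lemma clinear_exp_op:
  assumes D: "clinear D" and nil: "\<And>b. \<exists>N. \<forall>k>N. (D ^^ k) (bvec b) = 0"
  shows "clinear (exp_op D)"
proof -
  have lin: "clinear (D ^^ k)" for k
    by (induction k) (auto simp: clinear_iff clinear_simps[OF D])
  have nil_all: "\<exists>N. \<forall>k>N. (D ^^ k) t = 0" for t
  proof (induction t rule: vec_induct)
    case (add x y)
    then obtain N M where "\<forall>k>N. (D ^^ k) x = 0" "\<forall>k>M. (D ^^ k) y = 0"
      by blast
    then have "\<forall>k>max N M. (D ^^ k) (x + y) = 0"
      by (simp add: clinear_simps[OF lin])
    then show ?case ..
  next
    case (scale c x)
    then show ?case
      by (metis clinear_scale[OF lin] cscale_0(2))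
  qed (auto simp: clinear_simps[OF lin] nil)
  have eq: "exp_op D t = (\<Sum>k\<le>N. (1 / fact k) *\<^sub>c (D ^^ k) t)" if "\<forall>k>N. (D ^^ k) t = 0" for t N
    unfolding exp_op_def using that
    by (intro Sum_any.expand_superset) (auto simp: not_less[symmetric])
  show ?thesis
  proof (rule clinearI)
    fix x y
    obtain N M where "\<forall>k>N. (D ^^ k) x = 0" "\<forall>k>M. (D ^^ k) y = 0"
      using nil_all by blast
    then show "exp_op D (x + y) = exp_op D x + exp_op D y"
      by (simp add: eq[of "max N M"] clinear_simps[OF lin] sum.distrib)
  next
    fix c x
    obtain N where "\<forall>k>N. (D ^^ k) x = 0"
      using nil_all by blast
    then show "exp_op D (c *\<^sub>c x) = c *\<^sub>c exp_op D x"
      by (simp add: eq[of N] clinear_simps[OF lin] cscale_sum_right mult.commute)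
  qed
qed

lemma clinear_exp_op_d_p:
  assumes f: "clinear f"
  shows "clinear (exp_op (\<lambda>t. c *\<^sub>c tmap d_p f t))"
proof (rule clinear_exp_op)
  show "clinear (\<lambda>t. c *\<^sub>c tmap d_p f t)"
    by (auto intro!: clinearI simp: mult.commute)
  fix b :: "(nat \<times> int) \<times> 'a"
  obtain n r d where b: "b = ((n, r), d)"
    by (metis surj_pair)
  show "\<exists>N. \<forall>k>N. ((\<lambda>t. c *\<^sub>c tmap d_p f t) ^^ k) (bvec b) = 0"
  proof (intro exI[of _ n] allI impI)
    fix k assume "n < k"
    have d_p: "clinear d_p"
      by (simp add: d_p_def)
    have "((\<lambda>t. c *\<^sub>c tmap d_p f t) ^^ j) (bvec ((n, r), d)) =
        (c ^ j * (\<Prod>i<j. of_nat (n - i))) *\<^sub>c (bvec (n - j, r) \<otimes> (f ^^ j) (bvec d))" for j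
      by (induction j) (simp_all add: tmap_tens[OF d_p f], simp add: d_p_def mult_ac)
    moreover have "(\<Prod>i<k. of_nat (n - i)) = (0 :: complex)"
      using \<open>n < k\<close> by (auto intro!: bexI[of _ n])
    ultimately show "((\<lambda>t. c *\<^sub>c tmap d_p f t) ^^ k) (bvec b) = 0"
      by (simp only: b mult_zero_right cscale_0)
  qed
qed

section \<open>The functionals \<open>\<chi>\<close> and \<open>\<chi>\<^sup>-\<^sup>1\<close>\<close>

text \<open>The functional \<open>p\<^sup>n g\<^sup>r \<otimes> p\<^sup>m g\<^sup>s \<mapsto> \<delta>\<^sub>m\<^sub>,\<^sub>0 a\<^sup>n (c s) (c s - 1) \<cdots> (c s - n + 1)\<close>. The falling factorial
  is written with a generalised binomial coefficient to make Vandermonde's identity applicable.\<close>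

definition gpair :: "complex \<Rightarrow> complex \<Rightarrow> ((nat \<times> int) \<times> (nat \<times> int)) vec \<Rightarrow> complex"
  where "gpair a c = fun_ext (\<lambda>((n, r), (m, s)).
    if m = 0 then a ^ n * fact n * ((c * of_int s) gchoose n) else 0)"

lemma cfunctional_gpair [simp, intro]: "cfunctional (gpair a c)"
  by (simp add: gpair_def)

lemmas gpair_simps [simp] = cfunctional_simps[OF cfunctional_gpair]

lemma gpair_bvec: "gpair a c (bvec ((n, r), (m, s))) =
    (if m = 0 then a ^ n * fact n * ((c * of_int s) gchoose n) else 0)"
  by (simp add: gpair_def)

lemma gpair_gvec: "gpair a c (bvec (n, r) \<otimes> gvec s) = a ^ n * fact n * ((c * of_int s) gchoose n)"
  by (simp only: tens_bvec gpair_bvec) simp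

lemma gpair_vanish [simp]: "gpair a c (x \<otimes> bvec (Suc m, s)) = 0"
  by (induction x rule: vec_induct) (auto simp: gpair_def split: prod.splits)

lemma falling_prod_gbinomial: "(\<Prod>k<n. x - of_nat k) = fact n * (x gchoose n)" for x :: complex
  by (simp add: gbinomial_mult_fact atLeast0LessThan)

lemma chi_eq_gpair: "chi A = gpair (\<i> * A) (- 1)"
proof
  fix t
  have lin: "cfunctional (chi A)"
    unfolding chi_def cfunctional_iff
    by (simp add: clinear_simps[OF clinear_exp_op_d_p] d_ginv_def)
  show "chi A t = gpair (\<i> * A) (- 1) t"
  proof (rule cfunctional_eqI[OF lin cfunctional_gpair])
    fix b :: "(nat \<times> int) \<times> nat \<times> int"
    obtain n r m s where b: "b = ((n, r), (m, s))"
      by (metis surj_pair)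
    show "chi A (bvec b) = gpair (\<i> * A) (- 1) (bvec b)"
      using falling_prod_gbinomial[where n = n and x = "- of_int s"]
      by (simp add: b chi_bvec gpair_bvec)
  qed
qed

lemma chi_inv_eq_gpair: "chi_inv A = gpair (\<i> * A) 1"
proof
  fix t
  have lin: "cfunctional (chi_inv A)"
    unfolding chi_inv_def cfunctional_iff
    by (simp add: clinear_simps[OF clinear_exp_op_d_p] d_g_def)
  show "chi_inv A t = gpair (\<i> * A) 1 t"
  proof (rule cfunctional_eqI[OF lin cfunctional_gpair])
    fix b :: "(nat \<times> int) \<times> nat \<times> int"
    obtain n r m s where b: "b = ((n, r), (m, s))"
      by (metis surj_pair)
    show "chi_inv A (bvec b) = gpair (\<i> * A) 1 (bvec b)"
      using falling_prod_gbinomial[where n = n and x = "of_int s"]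
      by (simp add: b chi_inv_bvec gpair_bvec)
  qed
qed

lemma gpair_0: "gpair a 0 = tfun eps eps"
proof
  fix t
  have zero: "(0 :: complex) gchoose n = (if n = 0 then 1 else 0)" for n
    by (cases n) simp_all
  show "gpair a 0 t = tfun eps eps t"
    by (induction t rule: tens_induct)
      (auto simp: zero gpair_def tfun_def eps_bvec split: prod.splits)
qed

lemma gpair_unit: "gpair a c (1 \<otimes> h) = eps h"
proof (induction h rule: vec_induct)
  case (basis b)
  obtain m s where b: "b = (m, s)"
    by (cases b)
  have "gpair a c (gvec 0 \<otimes> bvec (m, s)) = eps (bvec (m, s))"
    by (simp only: tens_bvec gpair_bvec eps_bvec) simp
  then show ?case
    by (simp add: b)
qed simp_all

section \<open>The coproduct of a monomial\<close>

lemma of_nat_mult_vec: "of_nat k * x = of_nat k *\<^sub>c x" for x :: "'b::comm_monoid_add vec"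
  by (induction k) (simp_all add: distrib_right cscale_add_left)

lemma Delta_monomial:
  "Delta (bvec (n, r)) = (\<Sum>i\<le>n. of_nat (n choose i) *\<^sub>c (bvec (i, r) \<otimes> bvec (n - i, r + int i)))"
proof -
  have one: "bvec ((0::nat, 0::int), (0::nat, 0::int)) = 1"
    by (simp del: single_one add: one_eq_bvec zero_prod_def)
  have p: "(pvec \<otimes> gvec 1) ^ i = bvec ((i, 0), (0, int i))" for i
    by (induction i) (simp_all add: one)
  have q: "(gvec 0 \<otimes> pvec) ^ i = bvec ((0, 0), (i, 0))" for i
    by (induction i) (simp_all add: one del: gvec_0)
  show ?thesis
    unfolding Delta_bvec binomial_ring sum_distrib_right p q
    by (intro sum.cong) (auto simp: mult.assoc of_nat_mult_vec add.commute)
qed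

lemma Delta_sum_functional:
  assumes "cfunctional F"
  shows "F (Delta (bvec (n, r))) =
    (\<Sum>i\<le>n. of_nat (n choose i) * F (bvec (i, r) \<otimes> bvec (n - i, r + int i)))"
  by (simp only: Delta_monomial cfunctional_simps[OF assms])

text \<open>The only term of \<open>\<Delta> (p\<^sup>m g\<^sup>s)\<close> without \<open>p\<close> in the second factor is \<open>p\<^sup>m g\<^sup>s \<otimes> g\<^sup>s\<^sup>+\<^sup>m\<close>, and the only
  one without \<open>p\<close> in the first factor is \<open>g\<^sup>s \<otimes> p\<^sup>m g\<^sup>s\<close>. These two lemmas discard the other terms
  under additive maps; the codomain is left general to cover functionals and vector-valued maps.\<close>

lemma Delta_right_collapse:
  fixes F :: "((nat \<times> int) \<times> (nat \<times> int)) vec \<Rightarrow> 'a::ab_group_add"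
  assumes add: "\<And>x y. F (x + y) = F x + F y" and vanish: "\<And>x j t. F (x \<otimes> bvec (Suc j, t)) = 0"
  shows "F (Delta (bvec (m, s))) = F (bvec (m, s) \<otimes> gvec (s + int m))"
proof -
  have zero: "F 0 = 0"
    using add[of 0 0] by simp
  have sum: "F (sum f I) = (\<Sum>i\<in>I. F (f i))" for f and I :: "nat set"
    by (induction I rule: infinite_finite_induct) (auto simp: add zero)
  have "F (Delta (bvec (m, s))) =
      (\<Sum>i\<le>m. F ((of_nat (m choose i) *\<^sub>c bvec (i, s)) \<otimes> bvec (m - i, s + int i)))"
    unfolding Delta_monomial sum tens_scale_left ..
  also have "\<dots> = (\<Sum>i\<in>{m}. F ((of_nat (m choose i) *\<^sub>c bvec (i, s)) \<otimes> bvec (m - i, s + int i)))"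
  proof (rule sum.mono_neutral_right)
    show "\<forall>i\<in>{..m} - {m}. F ((of_nat (m choose i) *\<^sub>c bvec (i, s)) \<otimes> bvec (m - i, s + int i)) = 0"
    proof
      fix i assume "i \<in> {..m} - {m}"
      then obtain j where "m - i = Suc j"
        by (metis DiffD1 DiffD2 Suc_diff_Suc atMost_iff insertCI le_neq_implies_less)
      then show "F ((of_nat (m choose i) *\<^sub>c bvec (i, s)) \<otimes> bvec (m - i, s + int i)) = 0"
        by (simp only: vanish)
    qed
  qed auto
  finally show ?thesis
    by simp
qed

lemma Delta_left_collapse:
  fixes F :: "((nat \<times> int) \<times> (nat \<times> int)) vec \<Rightarrow> 'a::ab_group_add"
  assumes add: "\<And>x y. F (x + y) = F x + F y" and vanish: "\<And>x j t. F (bvec (Suc j, t) \<otimes> x) = 0"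
  shows "F (Delta (bvec (m, s))) = F (gvec s \<otimes> bvec (m, s))"
proof -
  have zero: "F 0 = 0"
    using add[of 0 0] by simp
  have sum: "F (sum f I) = (\<Sum>i\<in>I. F (f i))" for f and I :: "nat set"
    by (induction I rule: infinite_finite_induct) (auto simp: add zero)
  have "F (Delta (bvec (m, s))) =
      (\<Sum>i\<le>m. F (bvec (i, s) \<otimes> (of_nat (m choose i) *\<^sub>c bvec (m - i, s + int i))))"
    unfolding Delta_monomial sum tens_scale_right ..
  also have "\<dots> = (\<Sum>i\<in>{0}. F (bvec (i, s) \<otimes> (of_nat (m choose i) *\<^sub>c bvec (m - i, s + int i))))"
  proof (rule sum.mono_neutral_right)
    show "\<forall>i\<in>{..m} - {0}. F (bvec (i, s) \<otimes> (of_nat (m choose i) *\<^sub>c bvec (m - i, s + int i))) = 0"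
    proof
      fix i assume "i \<in> {..m} - {0}"
      then obtain j where "i = Suc j"
        by (metis DiffD2 insertCI old.nat.exhaust)
      then show "F (bvec (i, s) \<otimes> (of_nat (m choose i) *\<^sub>c bvec (m - i, s + int i))) = 0"
        by (simp only: vanish)
    qed
  qed auto
  finally show ?thesis
    by simp
qed

section \<open>Convolution and the cocycle identity\<close>

lemma comult2_tens: "comult2 CB (h \<otimes> g) = swap_mid (Delta h \<otimes> Delta g)"
  by (simp only: comult2_def swap_mid_def tmap_tens clinear_Delta)

lemma clinear_comult2 [simp, intro]: "clinear (comult2 CB)"
  by (simp add: comult2_def clinear_iff)

lemmas comult2_simps [simp] = clinear_simps[OF clinear_comult2]

text \<open>If \<open>p\<close> occurs in the second argument, both sides vanish. Otherwise the sum over the terms of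
  \<open>\<Delta> (p\<^sup>n g\<^sup>r)\<close> is Vandermonde's identity for \<open>c s\<close> and \<open>d s\<close>.\<close>

lemma conv_gpair: "conv CB (gpair a c) (gpair a d) = gpair a (c + d)"
proof
  fix t
  let ?F = "\<lambda>T S. tfun (gpair a c) (gpair a d) (swap_mid (T \<otimes> S))"
  have F_tens: "?F (h1 \<otimes> h2) (g1 \<otimes> g2) = gpair a c (h1 \<otimes> g1) * gpair a d (h2 \<otimes> g2)"
    for h1 h2 g1 g2
    by (simp only: swap_mid_tens tfun_tens cfunctional_gpair)
  have van1: "?F T (bvec (Suc j, t) \<otimes> x) = 0" for T j t x
  proof (induction T rule: tens_induct)
    case (tens b c)
    show ?case
      by (simp only: F_tens gpair_vanish mult_zero_left)
  qed simp_all
  have van2: "?F T (x \<otimes> bvec (Suc j, t)) = 0" for T j t x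
  proof (induction T rule: tens_induct)
    case (tens b c)
    show ?case
      by (simp only: F_tens gpair_vanish mult_zero_right)
  qed simp_all
  have step: "?F (Delta h) (Delta (bvec (m, s))) = ?F (Delta h) (gvec s \<otimes> bvec (m, s))" for h m s
    by (rule Delta_left_collapse) (simp, rule van1)
  show "conv CB (gpair a c) (gpair a d) t = gpair a (c + d) t"
  proof (induction t rule: tens_induct)
    case (tens x y)
    obtain n r m s where x: "x = (n, r)" and y: "y = (m, s)"
      by (metis surj_pair)
    have "conv CB (gpair a c) (gpair a d) (bvec x \<otimes> bvec y) = ?F (Delta (bvec x)) (gvec s \<otimes> bvec (m, s))"
      by (simp only: conv_def comult2_tens y step)
    also have "\<dots> = gpair a (c + d) (bvec x \<otimes> bvec y)"
    proof (cases m)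
      case 0
      have "?F (Delta (bvec x)) (gvec s \<otimes> bvec (m, s)) =
          (\<Sum>i\<le>n. of_nat (n choose i) * ?F (bvec (i, r) \<otimes> bvec (n - i, r + int i)) (gvec s \<otimes> gvec s))"
        unfolding 0 x by (rule Delta_sum_functional) (simp add: cfunctional_iff)
      also have "\<dots> = (\<Sum>i\<le>n. (a ^ n * fact n) *
          (((c * of_int s) gchoose i) * ((d * of_int s) gchoose (n - i))))"
      proof (rule sum.cong[OF refl])
        fix i assume "i \<in> {..n}"
        then have *: "of_nat (n choose i) * (fact i * fact (n - i)) = (fact n :: complex)"
          "a ^ i * a ^ (n - i) = a ^ n"
          by (simp_all add: binomial_fact flip: power_add)
        have "of_nat (n choose i) * ?F (bvec (i, r) \<otimes> bvec (n - i, r + int i)) (gvec s \<otimes> gvec s) =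
            (a ^ i * a ^ (n - i)) * (of_nat (n choose i) * (fact i * fact (n - i))) *
            (((c * of_int s) gchoose i) * ((d * of_int s) gchoose (n - i)))"
          by (simp only: F_tens gpair_gvec mult_ac)
        then show "of_nat (n choose i) * ?F (bvec (i, r) \<otimes> bvec (n - i, r + int i)) (gvec s \<otimes> gvec s) =
            (a ^ n * fact n) * (((c * of_int s) gchoose i) * ((d * of_int s) gchoose (n - i)))"
          by (simp only: *)
      qed
      also have "\<dots> = a ^ n * fact n * (((c + d) * of_int s) gchoose n)"
        by (simp only: atMost_atLeast0 gbinomial_Vandermonde distrib_right flip: sum_distrib_left)
      also have "\<dots> = gpair a (c + d) (bvec x \<otimes> bvec y)"
        by (simp only: x y 0 gpair_gvec)
      finally show ?thesis .
    next
      case (Suc m')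
      then show ?thesis
        by (simp only: y van2 gpair_vanish)
    qed
    finally show ?case .
  qed (simp_all add: conv_def)
qed

lemma tfunctional_gpair: "tfunctional CB (gpair a c)"
  by (simp add: tfunctional_def)

lemma conv_inverse_gpair: "conv_inverse CB (gpair a c) (gpair a (- c))"
  by (simp add: conv_inverse_def tfunctional_gpair conv_gpair gpair_0)

lemma fact_gbinomial_add:
  "fact (j + n) * (x gchoose (j + n)) = (fact n * (x gchoose n)) * (fact j * ((x - of_nat n) gchoose j))"
  for x :: complex
proof -
  have "(\<Prod>k<n + j. x - of_nat k) = (\<Prod>k<n. x - of_nat k) * (\<Prod>k<j. x - of_nat n - of_nat k)"
    by (induction j) (simp_all add: algebra_simps)
  then show ?thesis
    by (simp only: falling_prod_gbinomial add.commute)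
qed

text \<open>On monomials \<open>h = p\<^sup>m g\<^sup>t\<close>, \<open>g = p\<^sup>n g\<^sup>r\<close>, \<open>f = p\<^sup>l g\<^sup>s\<close>, both sides vanish for \<open>l > 0\<close>. For \<open>l = 0\<close>
  the left-hand side has a single term, and the right-hand side is a sum over the terms of \<open>\<Delta> h\<close>;
  after splitting off the falling factorial of \<open>- s\<close> of length \<open>n\<close>, this is Vandermonde's identity
  for \<open>- r\<close> and \<open>- s - n\<close>.\<close>

lemma cocycle_gpair:
  "fun_ext (\<lambda>(u, (c, d)). gpair a (- 1) (bvec u) * gpair a (- 1) (h \<otimes> (bvec c * bvec d))) (comult2 CB (g \<otimes> f)) =
   fun_ext (\<lambda>(u, (c, d)). gpair a (- 1) (bvec u) * gpair a (- 1) ((bvec c * bvec d) \<otimes> f)) (comult2 CB (h \<otimes> g))"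
  (is "?lhs h g f = ?rhs h g f")
proof -
  let ?\<chi> = "gpair a (- 1)"
  let ?L = "\<lambda>h T S. fun_ext (\<lambda>(u, (c, d)). ?\<chi> (bvec u) * ?\<chi> (h \<otimes> (bvec c * bvec d))) (swap_mid (T \<otimes> S))"
  let ?R = "\<lambda>f T S. fun_ext (\<lambda>(u, (c, d)). ?\<chi> (bvec u) * ?\<chi> ((bvec c * bvec d) \<otimes> f)) (swap_mid (T \<otimes> S))"
  have L_eq: "fun_ext (\<lambda>(u, (c, d)). ?\<chi> (bvec u) * ?\<chi> (h \<otimes> (bvec c * bvec d))) t =
      tfun ?\<chi> (\<lambda>t. ?\<chi> (h \<otimes> mult_lin (*) t)) t" for h t
    by (simp add: tfun_def split_def mult_lin_def)
  have R_eq: "fun_ext (\<lambda>(u, (c, d)). ?\<chi> (bvec u) * ?\<chi> ((bvec c * bvec d) \<otimes> f)) t =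
      tfun ?\<chi> (\<lambda>t. ?\<chi> (mult_lin (*) t \<otimes> f)) t" for f t
    by (simp add: tfun_def split_def mult_lin_def)
  have bil: "bilin ((*) :: (nat \<times> int) vec \<Rightarrow> _)"
    by (simp add: bilin_def)
  have fL: "cfunctional (\<lambda>t. ?\<chi> (h \<otimes> mult_lin (*) t))" and fR: "cfunctional (\<lambda>t. ?\<chi> (mult_lin (*) t \<otimes> f))" for h f
    by (simp_all add: cfunctional_iff)
  have L: "?L h (g1 \<otimes> g2) (f1 \<otimes> f2) = ?\<chi> (g1 \<otimes> f1) * ?\<chi> (h \<otimes> (g2 * f2))" for h g1 g2 f1 f2
    by (simp only: L_eq swap_mid_tens tfun_tens[OF cfunctional_gpair fL] mult_lin_tens[OF bil])
  have R: "?R f (h1 \<otimes> h2) (g1 \<otimes> g2) = ?\<chi> (h1 \<otimes> g1) * ?\<chi> ((h2 * g2) \<otimes> f)" for f h1 h2 g1 g2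
    by (simp only: R_eq swap_mid_tens tfun_tens[OF cfunctional_gpair fR] mult_lin_tens[OF bil])
  have vanish: "?\<chi> (x \<otimes> (y * bvec (Suc j, t))) = 0" for x y j t
  proof (induction y rule: vec_induct)
    case (basis b)
    show ?case
      by (cases b) (simp del: tens_bvec)
  qed (simp_all add: distrib_right)
  have L_van1: "?L h T (bvec (Suc j, t) \<otimes> x) = 0" for h T j t x
  proof (induction T rule: tens_induct)
    case (tens b c)
    show ?case
      by (simp only: L gpair_vanish mult_zero_left)
  qed simp_all
  have L_van2: "?L h T (x \<otimes> bvec (Suc j, t)) = 0" for h T j t x
  proof (induction T rule: tens_induct)
    case (tens b c)
    show ?case
      by (simp only: L vanish mult_zero_right)
  qed simp_all
  have L_van3: "?L h (x \<otimes> bvec (Suc j, t)) (y \<otimes> z) = 0" for h x j t y z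
    by (simp only: L mult.commute[of "bvec (Suc j, t)"] vanish mult_zero_right)
  have R_van1: "?R f T (bvec (Suc j, t) \<otimes> x) = 0" for f T j t x
  proof (induction T rule: tens_induct)
    case (tens b c)
    show ?case
      by (simp only: R gpair_vanish mult_zero_left)
  qed simp_all
  have L_collapse: "?L h T (Delta (bvec (l, s))) = ?L h T (gvec s \<otimes> bvec (l, s))" for h T l s
    by (rule Delta_left_collapse) (simp, rule L_van1)
  have L_collapse': "?L h (Delta (bvec (n, r))) (gvec s \<otimes> gvec s) =
      ?L h (bvec (n, r) \<otimes> gvec (r + int n)) (gvec s \<otimes> gvec s)" for h n r s
    by (rule Delta_right_collapse) (simp, rule L_van3)
  have R_collapse: "?R f T (Delta (bvec (n, r))) = ?R f T (gvec r \<otimes> bvec (n, r))" for f T n r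
    by (rule Delta_left_collapse) (simp, rule R_van1)
  have basis: "?lhs (bvec x) (bvec y) (bvec z) = ?rhs (bvec x) (bvec y) (bvec z)" for x y z
  proof -
    obtain m t n r l s where xyz: "x = (m, t)" "y = (n, r)" "z = (l, s)"
      by (metis surj_pair)
    show ?thesis
    proof (cases l)
      case (Suc l')
      have "?lhs (bvec x) (bvec y) (bvec z) = 0"
        by (simp only: comult2_tens xyz L_collapse Suc L_van2)
      moreover have "?rhs (bvec x) (bvec y) (bvec z) = 0"
        by (simp only: xyz Suc gpair_vanish mult_zero_right) (simp add: fun_ext_def)
      ultimately show ?thesis
        by simp
    next
      case 0
      have "?lhs (bvec x) (bvec y) (bvec z) =
          ?\<chi> (bvec (n, r) \<otimes> gvec s) * ?\<chi> (bvec (m, t) \<otimes> gvec (r + int n + s))"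
        by (simp only: comult2_tens xyz 0 L_collapse L_collapse' L) (simp only: bvec_mult add_Pair add_0)
      also have "\<dots> = a ^ (m + n) * (fact n * ((- of_int s) gchoose n)) *
          (fact m * ((- of_int s - of_nat n - of_int r) gchoose m))"
      proof -
        have "- 1 * of_int (r + int n + s) = (- of_int s - of_nat n - of_int r :: complex)"
          by simp
        then show ?thesis
          by (simp only: gpair_gvec power_add mult_ac mult_minus1)
      qed
      finally have lhs: "?lhs (bvec x) (bvec y) (bvec z) = a ^ (m + n) * (fact n * ((- of_int s) gchoose n)) *
          (fact m * ((- of_int s - of_nat n - of_int r) gchoose m))" .
      have "?rhs (bvec x) (bvec y) (bvec z) = ?R (gvec s) (Delta (bvec (m, t))) (gvec r \<otimes> bvec (n, r))"
        by (simp only: comult2_tens xyz 0 R_collapse)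
      also have "\<dots> = (\<Sum>i\<le>m. of_nat (m choose i) *
          ?R (gvec s) (bvec (i, t) \<otimes> bvec (m - i, t + int i)) (gvec r \<otimes> bvec (n, r)))"
        by (rule Delta_sum_functional) (simp add: cfunctional_iff)
      also have "\<dots> = (\<Sum>i\<le>m. (a ^ (m + n) * (fact n * ((- of_int s) gchoose n)) * fact m) *
          (((- of_int r) gchoose i) * ((- of_int s - of_nat n) gchoose (m - i))))"
      proof (rule sum.cong[OF refl])
        fix i assume "i \<in> {..m}"
        then have *: "of_nat (m choose i) * (fact i * fact (m - i)) = (fact m :: complex)"
          "a ^ i * a ^ (m - i + n) = a ^ (m + n)"
          by (simp_all add: binomial_fact flip: power_add)
        have "of_nat (m choose i) * ?R (gvec s) (bvec (i, t) \<otimes> bvec (m - i, t + int i)) (gvec r \<otimes> bvec (n, r))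
            = of_nat (m choose i) * ((a ^ i * fact i * ((- of_int r) gchoose i)) *
              (a ^ (m - i + n) * (fact (m - i + n) * ((- of_int s) gchoose (m - i + n)))))"
          by (simp only: R) (simp only: bvec_mult add_Pair gpair_gvec mult_minus1 mult.assoc)
        also have "\<dots> = (of_nat (m choose i) * (fact i * fact (m - i))) * (a ^ i * a ^ (m - i + n)) *
            (fact n * ((- of_int s) gchoose n)) * (((- of_int r) gchoose i) * ((- of_int s - of_nat n) gchoose (m - i)))"
          unfolding fact_gbinomial_add by (simp only: mult_ac)
        finally show "of_nat (m choose i) * ?R (gvec s) (bvec (i, t) \<otimes> bvec (m - i, t + int i)) (gvec r \<otimes> bvec (n, r)) =
          (a ^ (m + n) * (fact n * ((- of_int s) gchoose n)) * fact m) *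
          (((- of_int r) gchoose i) * ((- of_int s - of_nat n) gchoose (m - i)))"
          unfolding * by (simp only: mult_ac)
      qed
      also have "\<dots> = a ^ (m + n) * (fact n * ((- of_int s) gchoose n)) * fact m *
          ((- of_int r + (- of_int s - of_nat n)) gchoose m)"
        by (simp only: atMost_atLeast0 gbinomial_Vandermonde flip: sum_distrib_left)
      also have "- of_int r + (- of_int s - of_nat n) = (- of_int s - of_nat n - of_int r :: complex)"
        by simp
      finally show ?thesis
        unfolding lhs by (simp only: mult_ac)
    qed
  qed
  have 1: "?lhs h (bvec y) (bvec z) = ?rhs h (bvec y) (bvec z)" for h y z
    by (rule cfunctional_eqI[where f = "\<lambda>h. ?lhs h (bvec y) (bvec z)", OF _ _ basis], unfold cfunctional_iff)
      (simp_all only: split_def gpair_simps tens_add_left tens_scale_left tens_add_right distrib_left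
        fun_ext_plus_fun fun_ext_scale_fun comult2_simps fun_ext_add fun_ext_cscale mult.left_commute simp_thms)
  have 2: "?lhs h g (bvec z) = ?rhs h g (bvec z)" for h g z
    by (rule cfunctional_eqI[where f = "\<lambda>g. ?lhs h g (bvec z)", OF _ _ 1], unfold cfunctional_iff)
      (simp_all only: tens_add_left tens_scale_left tens_add_right tens_scale_right
        comult2_simps fun_ext_add fun_ext_cscale simp_thms)
  show ?thesis
    by (rule cfunctional_eqI[where f = "\<lambda>f. ?lhs h g f", OF _ _ 2], unfold cfunctional_iff)
      (simp_all only: split_def gpair_simps tens_add_right tens_scale_right distrib_left
        fun_ext_plus_fun fun_ext_scale_fun comult2_simps fun_ext_add fun_ext_cscale mult.left_commute simp_thms)
qed

lemma unital_2_cocycle_gpair: "unital_2_cocycle CB (gpair a (- 1))"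
proof -
  have "\<exists>\<psi>. conv_inverse CB (gpair a (- 1)) \<psi>"
    using conv_inverse_gpair by blast
  then show ?thesis
    by (simp only: unital_2_cocycle_def tfunctional_gpair CB_simps cocycle_gpair gpair_unit simp_thms)
qed

section \<open>The twofold coproduct of a monomial\<close>

text \<open>The index set of trinomial expansions.\<close>

definition triples :: "nat \<Rightarrow> (nat \<times> nat \<times> nat) set"
  where "triples n = {(i, j, k). i + j + k = n}"

lemma triples_mem [simp]: "(i, j, k) \<in> triples n \<longleftrightarrow> i + j + k = n"
  by (simp add: triples_def)

lemma finite_triples [simp]: "finite (triples n)"
  by (rule finite_subset[of _ "{..n} \<times> {..n} \<times> {..n}"]) (auto simp: triples_def)

lemma sum_triples_shift1:
  assumes "\<And>j k. f 0 j k = 0"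
  shows "(\<Sum>(i, j, k)\<in>triples (Suc n). f i j k) = (\<Sum>(i, j, k)\<in>triples n. f (Suc i) j k)"
proof -
  let ?h = "\<lambda>(i, j, k). (Suc i, j, k)"
  have "(\<Sum>(i, j, k)\<in>triples (Suc n). f i j k) = (\<Sum>(i, j, k)\<in>?h ` triples n. f i j k)"
  proof (rule sum.mono_neutral_right)
    show "\<forall>x\<in>triples (Suc n) - ?h ` triples n. (case x of (i, j, k) \<Rightarrow> f i j k) = 0"
    proof clarify
      fix i j k assume *: "(i, j, k) \<in> triples (Suc n)" "(i, j, k) \<notin> ?h ` triples n"
      have "i = 0"
      proof (rule ccontr)
        assume "i \<noteq> 0"
        then have "(i - 1, j, k) \<in> triples n" "(i, j, k) = ?h (i - 1, j, k)"
          using *(1) by auto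
        then show False
          using *(2) by (metis (no_types, lifting) imageI)
      qed
      then show "f i j k = 0"
        using assms by simp
    qed
  qed auto
  also have "\<dots> = (\<Sum>(i, j, k)\<in>triples n. f (Suc i) j k)"
    by (subst sum.reindex) (auto simp: inj_on_def intro!: sum.cong)
  finally show ?thesis .
qed

lemma sum_triples_shift2:
  assumes "\<And>i k. f i 0 k = 0"
  shows "(\<Sum>(i, j, k)\<in>triples (Suc n). f i j k) = (\<Sum>(i, j, k)\<in>triples n. f i (Suc j) k)"
proof -
  have flip: "(\<Sum>(i, j, k)\<in>triples m. g i j k) = (\<Sum>(i, j, k)\<in>triples m. g j i k)"
    for m and g :: "nat \<Rightarrow> nat \<Rightarrow> nat \<Rightarrow> 'a"
    by (rule sum.reindex_bij_witness[of _ "\<lambda>(i, j, k). (j, i, k)" "\<lambda>(i, j, k). (j, i, k)"]) auto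
  show ?thesis
    using sum_triples_shift1[of "\<lambda>i j k. f j i k" n] assms
    by (simp add: flip[of "\<lambda>i j k. f j i k"] flip[of "\<lambda>i j k. f j (Suc i) k"])
qed

lemma sum_triples_shift3:
  assumes "\<And>i j. f i j 0 = 0"
  shows "(\<Sum>(i, j, k)\<in>triples (Suc n). f i j k) = (\<Sum>(i, j, k)\<in>triples n. f i j (Suc k))"
proof -
  have flip: "(\<Sum>(i, j, k)\<in>triples m. g i j k) = (\<Sum>(i, j, k)\<in>triples m. g k j i)"
    for m and g :: "nat \<Rightarrow> nat \<Rightarrow> nat \<Rightarrow> 'a"
    by (rule sum.reindex_bij_witness[of _ "\<lambda>(i, j, k). (k, j, i)" "\<lambda>(i, j, k). (k, j, i)"]) auto
  show ?thesis
    using sum_triples_shift1[of "\<lambda>i j k. f k j i" n] assms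
    by (simp add: flip[of "\<lambda>i j k. f k j i"] flip[of "\<lambda>i j k. f k j (Suc i)"])
qed

text \<open>A Leibniz rule for trinomial sums: the factor \<open>n + 1 = i + j + k\<close> is distributed over the
  three indices, each of which is then shifted down by one.\<close>

lemma sum_triples_Suc:
  "of_nat (Suc n) *\<^sub>c (\<Sum>(i, j, k)\<in>triples (Suc n). t i j k) = (\<Sum>(i, j, k)\<in>triples n.
    of_nat (Suc i) *\<^sub>c t (Suc i) j k + of_nat (Suc j) *\<^sub>c t i (Suc j) k + of_nat (Suc k) *\<^sub>c t i j (Suc k))"
proof -
  have "of_nat (Suc n) *\<^sub>c (\<Sum>(i, j, k)\<in>triples (Suc n). t i j k) = (\<Sum>(i, j, k)\<in>triples (Suc n).
      of_nat i *\<^sub>c t i j k + of_nat j *\<^sub>c t i j k + of_nat k *\<^sub>c t i j k)"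
    unfolding cscale_sum_right
  proof (rule sum.cong[OF refl], clarify)
    fix i j k assume "(i, j, k) \<in> triples (Suc n)"
    then have "of_nat (Suc n) = (of_nat i + of_nat j + of_nat k :: complex)"
      by (metis triples_mem of_nat_add)
    then show "of_nat (Suc n) *\<^sub>c t i j k = of_nat i *\<^sub>c t i j k + of_nat j *\<^sub>c t i j k + of_nat k *\<^sub>c t i j k"
      by (simp only: cscale_add_left)
  qed
  also have "\<dots> = (\<Sum>(i, j, k)\<in>triples (Suc n). of_nat i *\<^sub>c t i j k) +
      (\<Sum>(i, j, k)\<in>triples (Suc n). of_nat j *\<^sub>c t i j k) +
      (\<Sum>(i, j, k)\<in>triples (Suc n). of_nat k *\<^sub>c t i j k)"
    by (simp add: split_def sum.distrib)
  also have "\<dots> = (\<Sum>(i, j, k)\<in>triples n. of_nat (Suc i) *\<^sub>c t (Suc i) j k) +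
      (\<Sum>(i, j, k)\<in>triples n. of_nat (Suc j) *\<^sub>c t i (Suc j) k) +
      (\<Sum>(i, j, k)\<in>triples n. of_nat (Suc k) *\<^sub>c t i j (Suc k))"
    using sum_triples_shift1[of "\<lambda>i j k. of_nat i *\<^sub>c t i j k" n]
      sum_triples_shift2[of "\<lambda>i j k. of_nat j *\<^sub>c t i j k" n]
      sum_triples_shift3[of "\<lambda>i j k. of_nat k *\<^sub>c t i j k" n] by simp
  finally show ?thesis
    by (simp add: split_def sum.distrib)
qed

lemma Delta2_monomial:
  "tmap Delta id (Delta (bvec (n, r))) = (\<Sum>(i, j, k)\<in>triples n.
    (fact n / (fact i * fact j * fact k)) *\<^sub>c bvec (((i, r), (j, r + int i)), (k, r + int i + int j)))"
proof -
  let ?c = "\<lambda>i j k. fact n / (fact i * fact j * fact k) :: complex"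
  have "tmap Delta id (Delta (bvec (n, r))) = (\<Sum>l\<le>n. \<Sum>i\<le>l.
      (of_nat (n choose l) * of_nat (l choose i)) *\<^sub>c
        bvec (((i, r), (l - i, r + int i)), (n - l, r + int l)))"
    by (simp only: Delta_monomial[of n] tmap_simps tmap_id_right[OF clinear_Delta]
        Delta_monomial clinear_sum[OF clinear_tens_left] cscale_sum_right tens_scale_left
        cscale_cscale) (simp only: tens_bvec)
  also have "\<dots> = (\<Sum>(l, i)\<in>(SIGMA l:{..n}. {..l}). (of_nat (n choose l) * of_nat (l choose i)) *\<^sub>c
        bvec (((i, r), (l - i, r + int i)), (n - l, r + int l)))"
    by (rule sum.Sigma) auto
  also have "\<dots> = (\<Sum>(i, j, k)\<in>triples n.
      ?c i j k *\<^sub>c bvec (((i, r), (j, r + int i)), (k, r + int i + int j)))"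
  proof (rule sum.reindex_bij_witness[of _ "\<lambda>(i, j, k). (i + j, i)" "\<lambda>(l, i). (i, l - i, n - l)"])
    fix x assume "x \<in> (SIGMA l:{..n}. {..l})"
    then obtain l i where x: "x = (l, i)" "i \<le> l" "l \<le> n"
      by auto
    have "of_nat (n choose l) * of_nat (l choose i) = ?c i (l - i) (n - l)"
      using x by (simp add: binomial_fact)
    then show "(case case x of (l, i) \<Rightarrow> (i, l - i, n - l) of (i, j, k) \<Rightarrow>
        ?c i j k *\<^sub>c bvec (((i, r), (j, r + int i)), (k, r + int i + int j))) =
      (case x of (l, i) \<Rightarrow> (of_nat (n choose l) * of_nat (l choose i)) *\<^sub>c
        bvec (((i, r), (l - i, r + int i)), (n - l, r + int l)))"
      using x by (simp add: of_nat_diff)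
  qed auto
  finally show ?thesis .
qed

lemma gbinomial_Suc_eq: "x gchoose Suc k = (x - of_nat k) / of_nat (Suc k) * (x gchoose k)"
  for x :: complex
  using gbinomial_mult_1[of x k] by (simp add: field_simps del: of_nat_Suc)

section \<open>The cocycle twist is the deformed algebra\<close>

text \<open>The left-hand side is, up to the factors \<open>g\<^sup>r\<close> and \<open>n!\<close>, the twisted product of \<open>p\<^sup>n g\<^sup>r\<close> and
  \<open>p\<^sup>m g\<^sup>s\<close>; see \<open>twist_mult_gpair\<close>.\<close>

lemma left_pn_sum:
  "(\<Sum>(i, j, k)\<in>triples n. (a ^ i * ((- of_int s) gchoose i) / fact j * (a ^ k * (of_int (s + int m) gchoose k)))
      *\<^sub>c bvec (j + m, s + int i))
    = (1 / fact n) *\<^sub>c left_pn a n (bvec (m, s))"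
proof (induction n)
  case 0
  have "triples 0 = {(0, 0, 0)}"
    by (auto simp: triples_def)
  then show ?case
    by simp
next
  case (Suc n)
  let ?c = "\<lambda>i j k. a ^ i * ((- of_int s) gchoose i) / fact j * (a ^ k * (of_int (s + int m) gchoose k))"
  let ?t = "\<lambda>i j k. ?c i j k *\<^sub>c bvec (j + m, s + int i)"
  have "of_nat (Suc n) *\<^sub>c (\<Sum>(i, j, k)\<in>triples (Suc n). ?t i j k) =
      (\<Sum>(i, j, k)\<in>triples n. left_p a (?t i j k) - (a * of_nat n) *\<^sub>c ?t i j k)"
    unfolding sum_triples_Suc
  proof (rule sum.cong[OF refl], clarify)
    fix i j k assume "(i, j, k) \<in> triples n"
    then have n: "of_nat n = (of_nat i + of_nat j + of_nat k :: complex)"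
      by auto
    define C where "C = ?c i j k"
    have 1: "of_nat (Suc i) * ?c (Suc i) j k = - (a * (of_int s + of_nat i)) * C"
      unfolding gbinomial_Suc_eq C_def by (simp add: field_simps del: of_nat_Suc)
    have 2: "of_nat (Suc j) * ?c i (Suc j) k = C"
      unfolding C_def by (simp add: field_simps del: of_nat_Suc)
    have 3: "of_nat (Suc k) * ?c i j (Suc k) = a * (of_int s + of_nat m - of_nat k) * C"
      unfolding gbinomial_Suc_eq C_def by (simp add: field_simps del: of_nat_Suc)
    show "of_nat (Suc i) *\<^sub>c ?t (Suc i) j k + of_nat (Suc j) *\<^sub>c ?t i (Suc j) k +
        of_nat (Suc k) *\<^sub>c ?t i j (Suc k) = left_p a (?t i j k) - (a * of_nat n) *\<^sub>c ?t i j k"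
      unfolding cscale_cscale 1 2 3 C_def[symmetric] left_p_simps left_p_bvec n
      by (simp add: algebra_simps cscale_add_left cscale_diff_left)
  qed
  also have "\<dots> = left_p a (\<Sum>(i, j, k)\<in>triples n. ?t i j k) - (a * of_nat n) *\<^sub>c (\<Sum>(i, j, k)\<in>triples n. ?t i j k)"
    by (simp add: cscale_sum_right sum_subtractf split_def)
  also have "\<dots> = (1 / fact n) *\<^sub>c left_pn a (Suc n) (bvec (m, s))"
    unfolding Suc by (simp add: mult.commute)
  finally have "(1 / of_nat (Suc n)) *\<^sub>c of_nat (Suc n) *\<^sub>c (\<Sum>(i, j, k)\<in>triples (Suc n). ?t i j k)
      = (1 / of_nat (Suc n)) *\<^sub>c (1 / fact n) *\<^sub>c left_pn a (Suc n) (bvec (m, s))"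
    by (rule arg_cong)
  then show ?case
    by (simp del: of_nat_Suc left_pn.simps add: mult.commute)
qed

text \<open>In \<open>\<chi>(h\<^sub>1 \<otimes> y\<^sub>1) h\<^sub>2 y\<^sub>2 \<chi>\<^sup>-\<^sup>1(h\<^sub>3 \<otimes> y\<^sub>3)\<close> with \<open>y = p\<^sup>m g\<^sup>s\<close>, only \<open>y\<^sub>1 = g\<^sup>s\<close>, \<open>y\<^sub>2 = y\<close>,
  \<open>y\<^sub>3 = g\<^sup>s\<^sup>+\<^sup>m\<close> contributes, which leaves a sum over the twofold coproduct of \<open>h\<close>.\<close>

lemma twist_mult_gpair: "twist_mult CB (gpair a (- 1)) (gpair a 1) = dmult a"
proof -
  let ?\<chi> = "gpair a (- 1)" and ?\<psi> = "gpair a 1"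
  let ?V = "lin_ext (\<lambda>((u, (c, d)), w). (?\<chi> (bvec u) * ?\<psi> (bvec w)) *\<^sub>c (bvec c * bvec d :: (nat \<times> int) vec))"
  let ?F = "\<lambda>T S. ?V (tmap (comult2 CB) id (swap_mid (T \<otimes> S)))"
  have bil: "bilin ((*) :: (nat \<times> int) vec \<Rightarrow> _)"
    by (simp add: bilin_def)
  have V: "?V ((t1 \<otimes> t2) \<otimes> t3) = (?\<chi> t1 * ?\<psi> t3) *\<^sub>c mult_lin (*) t2" for t1 t2 t3
  proof (induction t1 rule: vec_induct)
    case (basis b)
    show ?case
    proof (induction t2 rule: vec_induct)
      case (basis c)
      show ?case
        by (induction t3 rule: vec_induct)
          (simp_all add: distrib_left distrib_right cscale_add_left mult_ac,
           simp add: split_def mult_lin_def)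
    qed (simp_all add: mult_ac)
  qed (simp_all add: distrib_left distrib_right cscale_add_left mult_ac)
  have V_tens: "?V (swap_mid ((a1 \<otimes> a2) \<otimes> (x \<otimes> y)) \<otimes> w) = (?\<chi> (a1 \<otimes> x) * ?\<psi> w) *\<^sub>c (a2 * y)"
    for a1 a2 x y w
    by (simp only: swap_mid_tens V mult_lin_tens[OF bil])
  have F_tens: "?F (b \<otimes> c) (x \<otimes> y) = ?V (swap_mid (Delta b \<otimes> Delta x) \<otimes> (c \<otimes> y))" for b c x y
    by (simp only: swap_mid_tens tmap_id_right[OF clinear_comult2] comult2_tens)
  have V_van1: "?V (swap_mid (T \<otimes> (bvec (Suc j, t) \<otimes> x)) \<otimes> w) = 0" for T j t x w
  proof (induction T rule: tens_induct)
    case (tens b c)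
    show ?case
      by (simp only: V_tens gpair_vanish mult_zero_left cscale_0)
  qed simp_all
  have V_van2: "?V (u \<otimes> w) = 0" if "?\<psi> w = 0" for u w
  proof (induction u rule: tens_induct)
    case (tens b c)
    show ?case
      by (simp only: V that mult_zero_right cscale_0)
  qed simp_all
  have F_van: "?F T (x \<otimes> bvec (Suc j, t)) = 0" for T j t x
  proof (induction T rule: tens_induct)
    case (tens b c)
    show ?case
      by (simp only: F_tens V_van2 gpair_vanish)
  qed simp_all
  have V_collapse: "?V (swap_mid (T \<otimes> Delta (bvec (m, s))) \<otimes> w) =
      ?V (swap_mid (T \<otimes> (gvec s \<otimes> bvec (m, s))) \<otimes> w)" for T m s w
    by (rule Delta_left_collapse) (simp, rule V_van1)
  have F_collapse: "?F T (Delta (bvec (m, s))) = ?F T (bvec (m, s) \<otimes> gvec (s + int m))" for T m s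
    by (rule Delta_right_collapse) (simp, rule F_van)
  have basis: "twist_mult CB ?\<chi> ?\<psi> (bvec x) (bvec y) = dmult a (bvec x) (bvec y)" for x y
  proof -
    obtain n r m s where xy: "x = (n, r)" "y = (m, s)"
      by (metis surj_pair)
    let ?W = "lin_ext (\<lambda>((b, c), d).
      (?\<chi> (bvec b \<otimes> gvec s) * ?\<psi> (bvec d \<otimes> gvec (s + int m))) *\<^sub>c (bvec c * bvec (m, s)))"
    have W1: "?V (swap_mid (T \<otimes> (gvec s \<otimes> bvec (m, s))) \<otimes> (bvec d \<otimes> gvec (s + int m))) = ?W (T \<otimes> bvec d)" for T d
    proof (induction T rule: tens_induct)
      case (tens b c)
      have "?W ((bvec b \<otimes> bvec c) \<otimes> bvec d) = (?\<chi> (bvec b \<otimes> gvec s) *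
          ?\<psi> (bvec d \<otimes> gvec (s + int m))) *\<^sub>c (bvec c * bvec (m, s))"
        by (simp only: tens_bvec lin_ext_bvec prod.case)
      then show ?case
        by (simp only: V_tens)
    qed simp_all
    have W2: "?F T (bvec (m, s) \<otimes> gvec (s + int m)) = ?W (tmap Delta id T)" for T
    proof (induction T rule: tens_induct)
      case (tens b c)
      show ?case
        by (simp only: F_tens V_collapse W1 tmap_id_right[OF clinear_Delta])
    qed simp_all
    have "twist_mult CB ?\<chi> ?\<psi> (bvec x) (bvec y) = ?W (tmap Delta id (Delta (bvec (n, r))))"
      by (simp only: twist_mult_def CB_simps comult2_tens xy F_collapse W2)
    also have "\<dots> = (\<Sum>(i, j, k)\<in>triples n. fact n *\<^sub>c (gvec r *
        ((a ^ i * ((- of_int s) gchoose i) / fact j * (a ^ k * (of_int (s + int m) gchoose k)))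
          *\<^sub>c bvec (j + m, s + int i))))"
      unfolding Delta2_monomial clinear_sum[OF clinear_lin_ext]
    proof (rule sum.cong[OF refl], clarify)
      fix i j k
      have "?W ((fact n / (fact i * fact j * fact k)) *\<^sub>c bvec (((i, r), (j, r + int i)), (k, r + int i + int j))) =
          ((fact n / (fact i * fact j * fact k)) * ((a ^ i * fact i * ((- 1 * of_int s) gchoose i)) *
           (a ^ k * fact k * ((1 * of_int (s + int m)) gchoose k)))) *\<^sub>c (bvec (j, r + int i) * bvec (m, s))"
        by (simp only: lin_ext_cscale lin_ext_bvec prod.case gpair_gvec cscale_cscale)
      also have "bvec (j, r + int i) * bvec (m, s) = gvec r * bvec (j + m, s + int i)"
        by (simp add: algebra_simps)
      finally show "?W ((fact n / (fact i * fact j * fact k)) *\<^sub>c bvec (((i, r), (j, r + int i)), (k, r + int i + int j))) =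
          fact n *\<^sub>c (gvec r * ((a ^ i * ((- of_int s) gchoose i) / fact j * (a ^ k * (of_int (s + int m) gchoose k)))
          *\<^sub>c bvec (j + m, s + int i)))"
        by (simp only: cscale_mult_right cscale_cscale mult_minus1 mult_1_left) (simp add: field_simps)
    qed
    also have "\<dots> = fact n *\<^sub>c (gvec r * ((1 / fact n) *\<^sub>c left_pn a n (bvec (m, s))))"
      unfolding left_pn_sum[symmetric] by (simp add: cscale_sum_right sum_distrib_left split_def)
    also have "\<dots> = dmult a (bvec x) (bvec y)"
      by (simp add: xy dmult_bvec)
    finally show ?thesis .
  qed
  have "bilin (twist_mult CB ?\<chi> ?\<psi>)"
    by (simp add: bilin_def clinear_iff twist_mult_def)
  then show ?thesis
    by (intro bilin_eqI bilin_dmult basis)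
qed

lemma antipode_CB_bvec: "antipode CB (bvec (n, r)) = (- 1) ^ n *\<^sub>c bvec (n, - r - int n)"
proof -
  have "(- bvec (1, - 1)) ^ n * bvec (0, s) = (- 1) ^ n *\<^sub>c (bvec (n, s - int n) :: (nat \<times> int) vec)" for s
    by (induction n) (simp_all add: mult.assoc diff_diff_eq add.commute)
  then show ?thesis
    by (simp add: CB_def)
qed

lemma clinear_antipode_CB [simp, intro]: "clinear (antipode CB)"
  by (simp add: CB_def)

text \<open>The left-hand side is, up to the factor \<open>n!\<close>, the twisted antipode of \<open>p\<^sup>n g\<^sup>r\<close>; see
  \<open>twist_antipode_gpair\<close>. Unlike in \<open>left_pn_sum\<close>, the summand depends on \<open>n\<close>. The proof therefore
  rewrites the binomial coefficient of \<open>n + 1 + r\<close> over \<open>k\<close> by those of \<open>n + r\<close> before shifting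
  the indices.\<close>

lemma antipode_mon_sum:
  "(\<Sum>(i, j, k)\<in>triples n. (a ^ i * (of_int (int i + r) gchoose i) * ((- 1) ^ j / fact j) *
      ((- a) ^ k * (of_int (int n + r) gchoose k))) *\<^sub>c bvec (j, - (int i + int j + r)))
    = (1 / fact n) *\<^sub>c antipode_mon a n r"
proof (induction n)
  case 0
  have "triples 0 = {(0, 0, 0)}"
    by (auto simp: triples_def)
  then show ?case
    by simp
next
  case (Suc n)
  have spread: "S * (B * (D * X)) = p * (B * (D * Y)) + q * (B * (D * Y)) + w * B * (D * Z)"
    if "S * X = (p + q) * Y + w * Z" for S B D X Y Z p q w :: complex
  proof -
    have "S * (B * (D * X)) = B * D * (S * X)"
      by (simp only: mult_ac)
    also have "\<dots> = p * (B * (D * Y)) + q * (B * (D * Y)) + w * B * (D * Z)"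
      unfolding that by (simp only: distrib_left distrib_right mult_ac)
    finally show ?thesis .
  qed
  let ?b = "\<lambda>i j. a ^ i * (of_int (int i + r) gchoose i) * ((- 1) ^ j / fact j) :: complex"
  let ?v = "\<lambda>i j. bvec (j, - (int i + int j + r)) :: (nat \<times> int) vec"
  let ?t = "\<lambda>i j k. (?b i j * ((- a) ^ k * (of_int (int n + r) gchoose k))) *\<^sub>c ?v i j"
  let ?N = "of_int (int n + r) :: complex"
  \<comment> \<open>The part of the summand for \<open>n + 1\<close> that is shifted in \<open>k\<close>. It is the remainder after the parts
    shifted in \<open>i\<close> and \<open>j\<close>; by Pascal's rule and absorption it is a multiple of the binomial
    coefficient over \<open>k - 1\<close>, and it vanishes at \<open>k = 0\<close>.\<close>
  let ?g = "\<lambda>i j k. if k = 0 then 0 else ((of_nat i + of_nat j + ?N + 1) * ?b i j *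
      ((- a) ^ k * (?N gchoose (k - 1)))) *\<^sub>c ?v i j"
  have "of_nat (Suc n) *\<^sub>c (\<Sum>(i, j, k)\<in>triples (Suc n).
        (?b i j * ((- a) ^ k * (of_int (int (Suc n) + r) gchoose k))) *\<^sub>c ?v i j) =
      (\<Sum>(i, j, k)\<in>triples (Suc n). of_nat i *\<^sub>c ?t i j k + of_nat j *\<^sub>c ?t i j k + ?g i j k)"
    unfolding cscale_sum_right
  proof (rule sum.cong[OF refl], clarify)
    fix i j k assume "(i, j, k) \<in> triples (Suc n)"
    then have n: "of_nat (Suc n) = (of_nat i + of_nat j + of_nat k :: complex)"
      by (metis triples_mem of_nat_add)
    have N: "of_int (int (Suc n) + r) = ?N + 1"
      by simp
    show "of_nat (Suc n) *\<^sub>c (?b i j * ((- a) ^ k * (of_int (int (Suc n) + r) gchoose k))) *\<^sub>c ?v i j =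
      of_nat i *\<^sub>c ?t i j k + of_nat j *\<^sub>c ?t i j k + ?g i j k"
    proof (cases k)
      case 0
      then show ?thesis
        unfolding n by (simp add: cscale_add_left[symmetric] algebra_simps add_divide_distrib)
    next
      case (Suc l)
      have "of_nat (Suc l) * (?N gchoose Suc l) = (?N - of_nat l) * (?N gchoose l)"
        unfolding gbinomial_Suc_eq by (simp del: of_nat_Suc)
      then have "(of_nat i + of_nat j + of_nat (Suc l)) * ((?N + 1) gchoose Suc l) =
          (of_nat i + of_nat j) * (?N gchoose Suc l) + (of_nat i + of_nat j + ?N + 1) * (?N gchoose l)"
        unfolding gbinomial_Suc_Suc by (simp add: algebra_simps)
      then have "(of_nat i + of_nat j + of_nat (Suc l)) * (?b i j * ((- a) ^ Suc l * ((?N + 1) gchoose Suc l))) =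
          of_nat i * (?b i j * ((- a) ^ Suc l * (?N gchoose Suc l))) +
          of_nat j * (?b i j * ((- a) ^ Suc l * (?N gchoose Suc l))) +
          (of_nat i + of_nat j + ?N + 1) * ?b i j * ((- a) ^ Suc l * (?N gchoose l))"
        by (rule spread)
      then show ?thesis
        unfolding n N Suc by (simp only: cscale_cscale diff_Suc_1 nat.simps if_False flip: cscale_add_left)
    qed
  qed
  also have "\<dots> = (\<Sum>(i, j, k)\<in>triples n. of_nat (Suc i) *\<^sub>c ?t (Suc i) j k +
      of_nat (Suc j) *\<^sub>c ?t i (Suc j) k + ?g i j (Suc k))"
    using sum_triples_shift1[of "\<lambda>i j k. of_nat i *\<^sub>c ?t i j k" n]
      sum_triples_shift2[of "\<lambda>i j k. of_nat j *\<^sub>c ?t i j k" n] sum_triples_shift3[of ?g n]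
    by (simp add: split_def sum.distrib del: of_nat_Suc power_Suc)
  also have "\<dots> = (\<Sum>(i, j, k)\<in>triples n. - left_p a (gvec (- 1) * ?t i j k) - (a * of_nat n) *\<^sub>c ?t i j k)"
  proof (rule sum.cong[OF refl], clarify)
    fix i j k
    define C where "C = ?b i j * ((- a) ^ k * (?N gchoose k))"
    have abs: "of_nat (Suc i) * (of_int (int (Suc i) + r) gchoose Suc i) =
        (of_int (int (Suc i) + r) :: complex) * (of_int (int i + r) gchoose i)"
      using gbinomial_absorption[of i "of_int (int (Suc i) + r) :: complex"] by simp
    have z: "of_int (int (Suc i) + r) = (of_nat i + of_int r + 1 :: complex)"
      by simp
    have "of_nat (Suc i) * (?b (Suc i) j * ((- a) ^ k * (?N gchoose k))) =
        a ^ Suc i * (of_nat (Suc i) * (of_int (int (Suc i) + r) gchoose Suc i)) * ((- 1) ^ j / fact j) *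
        ((- a) ^ k * (?N gchoose k))"
      by (simp only: mult_ac)
    also have "\<dots> = a * (of_nat i + of_int r + 1) * C"
      unfolding abs unfolding C_def z by (simp only: power_Suc mult_ac)
    finally have 1: "of_nat (Suc i) * (?b (Suc i) j * ((- a) ^ k * (?N gchoose k))) =
        a * (of_nat i + of_int r + 1) * C" .
    have 2: "of_nat (Suc j) * (?b i (Suc j) * ((- a) ^ k * (?N gchoose k))) = - C"
      unfolding C_def by (simp add: field_simps del: of_nat_Suc)
    have 3: "?g i j (Suc k) = (- (a * (of_nat i + of_nat j + ?N + 1)) * C) *\<^sub>c ?v i j"
      unfolding C_def by (simp add: algebra_simps)
    have v: "gvec (- 1) * ?v i j = bvec (j, - (int i + int j + r) - 1)"
      "?v (Suc i) j = bvec (j, - (int i + int j + r) - 1)"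
      "?v i (Suc j) = bvec (Suc j, - (int i + int j + r) - 1)"
    proof -
      have "- 1 + - (int i + int j + r) = - (int i + int j + r) - 1"
        "- (int (Suc i) + int j + r) = - (int i + int j + r) - 1"
        "- (int i + int (Suc j) + r) = - (int i + int j + r) - 1"
        by simp_all
      then show "gvec (- 1) * ?v i j = bvec (j, - (int i + int j + r) - 1)"
        "?v (Suc i) j = bvec (j, - (int i + int j + r) - 1)"
        "?v i (Suc j) = bvec (Suc j, - (int i + int j + r) - 1)"
        by (simp_all only: bvec_mult add_Pair add_0)
    qed
    show "of_nat (Suc i) *\<^sub>c ?t (Suc i) j k + of_nat (Suc j) *\<^sub>c ?t i (Suc j) k + ?g i j (Suc k) =
      - left_p a (gvec (- 1) * ?t i j k) - (a * of_nat n) *\<^sub>c ?t i j k"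
      unfolding 3 cscale_cscale 1 2 C_def[symmetric] cscale_mult_right v left_p_simps left_p_bvec
      by (simp add: algebra_simps cscale_add_left cscale_diff_left)
  qed
  also have "\<dots> = - left_p a (gvec (- 1) * (\<Sum>(i, j, k)\<in>triples n. ?t i j k))
      - (a * of_nat n) *\<^sub>c (\<Sum>(i, j, k)\<in>triples n. ?t i j k)"
    by (simp add: cscale_sum_right sum_subtractf sum_negf sum_distrib_left split_def)
  also have "\<dots> = (1 / fact n) *\<^sub>c antipode_mon a (Suc n) r"
    unfolding Suc by (simp add: mult.commute)
  finally have "(1 / of_nat (Suc n)) *\<^sub>c of_nat (Suc n) *\<^sub>c (\<Sum>(i, j, k)\<in>triples (Suc n).
        (?b i j * ((- a) ^ k * (of_int (int (Suc n) + r) gchoose k))) *\<^sub>c ?v i j)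
      = (1 / of_nat (Suc n)) *\<^sub>c (1 / fact n) *\<^sub>c antipode_mon a (Suc n) r"
    by (rule arg_cong)
  then show ?case
    by (simp del: of_nat_Suc antipode_mon.simps add: mult.commute)
qed

lemma twist_antipode_gpair: "twist_antipode CB (gpair a (- 1)) (gpair a 1) = dantipode a"
proof
  fix h
  let ?\<chi> = "gpair a (- 1)" and ?\<psi> = "gpair a 1" and ?S = "antipode CB"
  have U: "?\<chi> (tmap id ?S (Delta (bvec (n, r)))) = a ^ n * fact n * (of_int (int n + r) gchoose n)" for n r
  proof -
    have van: "?\<chi> (tmap id ?S (x \<otimes> bvec (Suc j, t))) = 0" for x j t
      by (simp only: tmap_id_left[OF clinear_antipode_CB] antipode_CB_bvec tens_scale_right gpair_simps
        gpair_vanish mult_zero_right)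
    have "?\<chi> (tmap id ?S (Delta (bvec (n, r)))) = ?\<chi> (tmap id ?S (bvec (n, r) \<otimes> gvec (r + int n)))"
      by (rule Delta_right_collapse) (simp, rule van)
    also have "\<dots> = ?\<chi> (bvec (n, r) \<otimes> gvec (- (int n + r)))"
      by (simp only: tmap_id_left[OF clinear_antipode_CB] antipode_CB_bvec) (simp add: algebra_simps)
    also have "\<dots> = a ^ n * fact n * (of_int (int n + r) gchoose n)"
      unfolding gpair_gvec by (simp add: add.commute)
    finally show ?thesis .
  qed
  have U': "?\<psi> (tmap ?S id (Delta (bvec (n, r)))) = (- a) ^ n * fact n * (of_int (int n + r) gchoose n)" for n r
  proof -
    have van: "?\<psi> (tmap ?S id (x \<otimes> bvec (Suc j, t))) = 0" for x j t
      by (simp only: tmap_id_right[OF clinear_antipode_CB] gpair_vanish)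
    have "?\<psi> (tmap ?S id (Delta (bvec (n, r)))) = ?\<psi> (tmap ?S id (bvec (n, r) \<otimes> gvec (r + int n)))"
      by (rule Delta_right_collapse) (simp, rule van)
    also have "\<dots> = (- 1) ^ n * (a ^ n * fact n * ((1 * of_int (r + int n)) gchoose n))"
      by (simp only: tmap_id_right[OF clinear_antipode_CB] antipode_CB_bvec tens_scale_left gpair_simps gpair_gvec)
    also have "\<dots> = (- a) ^ n * fact n * (of_int (int n + r) gchoose n)"
      by (simp add: power_minus[of a] add.commute)
    finally show ?thesis .
  qed
  let ?W = "lin_ext (\<lambda>((b, c), d). (?\<chi> (tmap id ?S (Delta (bvec b))) *
         ?\<psi> (tmap ?S id (Delta (bvec d)))) *\<^sub>c ?S (bvec c))"
  have "?W (tmap Delta id (Delta h)) = dantipode a h"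
  proof (rule clinear_eqI[where f = "\<lambda>h. ?W (tmap Delta id (Delta h))"])
    show "clinear (\<lambda>h. ?W (tmap Delta id (Delta h)))"
      by (auto intro: clinearI)
    fix b :: "nat \<times> int"
    obtain n r where b: "b = (n, r)"
      by (cases b)
    have "?W (tmap Delta id (Delta (bvec (n, r)))) = (\<Sum>(i, j, k)\<in>triples n. fact n *\<^sub>c
        ((a ^ i * (of_int (int i + r) gchoose i) * ((- 1) ^ j / fact j) *
        ((- a) ^ k * (of_int (int n + r) gchoose k))) *\<^sub>c bvec (j, - (int i + int j + r))))"
      unfolding Delta2_monomial clinear_sum[OF clinear_lin_ext]
    proof (rule sum.cong[OF refl], clarify)
      fix i j k assume "(i, j, k) \<in> triples n"
      then have n: "int k + (r + int i + int j) = int n + r"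
        by auto
      have "?W ((fact n / (fact i * fact j * fact k)) *\<^sub>c bvec (((i, r), (j, r + int i)), (k, r + int i + int j))) =
          ((fact n / (fact i * fact j * fact k)) * ((a ^ i * fact i * (of_int (int i + r) gchoose i)) *
           ((- a) ^ k * fact k * (of_int (int n + r) gchoose k))) * (- 1) ^ j) *\<^sub>c
           bvec (j, - (r + int i) - int j)"
        by (simp only: lin_ext_cscale lin_ext_bvec prod.case U U' n antipode_CB_bvec cscale_cscale mult.assoc)
      also have "- (r + int i) - int j = - (int i + int j + r)"
        by simp
      finally show "?W ((fact n / (fact i * fact j * fact k)) *\<^sub>c bvec (((i, r), (j, r + int i)), (k, r + int i + int j))) =
        fact n *\<^sub>c ((a ^ i * (of_int (int i + r) gchoose i) * ((- 1) ^ j / fact j) *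
        ((- a) ^ k * (of_int (int n + r) gchoose k))) *\<^sub>c bvec (j, - (int i + int j + r)))"
        by (simp only: cscale_cscale) (simp add: field_simps)
    qed
    also have "\<dots> = fact n *\<^sub>c ((1 / fact n) *\<^sub>c antipode_mon a n r)"
      unfolding antipode_mon_sum[symmetric] by (simp add: cscale_sum_right split_def)
    finally show "?W (tmap Delta id (Delta (bvec b))) = dantipode a (bvec b)"
      by (simp add: b dantipode_bvec)
  qed simp
  then show "twist_antipode CB ?\<chi> ?\<psi> h = dantipode a h"
    by (simp only: twist_antipode_def)
qed

lemma cocycle_twist_eq: "cocycle_twist CB (chi A) (chi_inv A) = planck_model (\<i> * A)"
  by (simp only: cocycle_twist_def chi_eq_gpair chi_inv_eq_gpair twist_mult_gpair twist_antipode_gpair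
    planck_model_def)

section \<open>Transfer of Hopf algebra structures along surjections\<close>

text \<open>A structure \<open>H\<close> on a quotient \<open>V / ker f\<close> is a Hopf algebra, and \<open>f\<close> an isomorphism, as soon
  as the surjection \<open>f\<close> onto a Hopf algebra \<open>K\<close> with trivial null space respects all structure
  maps. Each axiom of \<open>H\<close> modulo the null space says that some tensor power of \<open>f\<close> kills an
  element, hence follows from the corresponding equation in \<open>K\<close>.\<close>

lemma hopf_transfer:
  assumes K: "hopf_algebra K" "null K = {0}"
    and f: "clinear f" "surj f" and null: "null H = {x. f x = 0}"
    and lin: "bilin (mult H)" "clinear (comult H)" "cfunctional (counit H)" "clinear (antipode H)"
    and f_mult: "\<And>x y. f (mult H x y) = mult K (f x) (f y)"
    and f_unit: "f (unit H) = unit K"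
    and f_comult: "\<And>x. tmap f f (comult H x) = comult K (f x)"
    and f_counit: "\<And>x. counit K (f x) = counit H x"
    and f_antipode: "\<And>x. f (antipode H x) = antipode K (f x)"
  shows "hopf_algebra H" and "hopf_iso H K f"
proof -
  interpret K: hopf_algebra K by (rule K(1))
  note eqs = K.mult_assoc K.unit_left K.unit_right K.coassoc K.counit_left K.counit_right
    K.comult_mult K.comult_unit K.antipode_left K.antipode_right
  note K_eqs = eqs[unfolded K(2) tnull_trivial singleton_iff right_minus_eq]
  have bilK: "bilin (mult K)"
    by (simp add: bilin_def K.mult_linear_left K.mult_linear_right)
  have null2: "tnull (null H) (null H) = {t. tmap f f t = 0}"
    unfolding null by (rule tnull_kernel[OF f f])
  have null3: "tnull (null H) (tnull (null H) (null H)) = {t. tmap f (tmap f f) t = 0}"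
    unfolding null2 unfolding null by (rule tnull_kernel[OF f clinear_tmap surj_tmap[OF f f]])
  note f_simps = clinear_simps[OF f(1)]
  have f_tmult: "tmap f f (tmult (mult H) s t) = tmult (mult K) (tmap f f s) (tmap f f t)" for s t
  proof (induction s rule: tens_induct)
    case (tens b c)
    show ?case
    proof (induction t rule: tens_induct)
      case (tens b' c')
      show ?case
        by (simp only: tmult_tens[OF lin(1)] tmult_tens[OF bilK] tmap_tens[OF f(1) f(1)] f_mult)
    qed (simp_all del: tens_bvec)
  qed simp_all
  have coassoc: "tmap f (tmap f f) (tassoc (tmap (comult H) id (comult H x))) =
      tmap f (tmap f f) (tmap id (comult H) (comult H x))" for x
  proof -
    have "tmap f (tmap f f) (tassoc (tmap (comult H) id (comult H x))) =
        tassoc (tmap (\<lambda>x. comult K (f x)) (\<lambda>x. id (f x)) (comult H x))"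
      by (simp add: tassoc_tmap[OF f(1) f(1) f(1)] tmap_tmap[OF clinear_tmap f(1)] f_comult)
    also have "\<dots> = tassoc (tmap (comult K) id (comult K (f x)))"
      by (simp only: f_comult[symmetric] tmap_tmap[OF K.comult_linear clinear_id(1)])
    also have "\<dots> = tmap id (comult K) (comult K (f x))"
      by (rule K_eqs)
    also have "\<dots> = tmap (\<lambda>x. id (f x)) (\<lambda>x. comult K (f x)) (comult H x)"
      by (simp only: f_comult[symmetric] tmap_tmap[OF clinear_id(1) K.comult_linear])
    also have "\<dots> = tmap f (tmap f f) (tmap id (comult H) (comult H x))"
      by (simp add: tmap_tmap[OF f(1) clinear_tmap] f_comult)
    finally show ?thesis .
  qed
  have counit_l: "f (lin_ext (\<lambda>(a, b). counit H (bvec a) *\<^sub>c bvec b) t) =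
      lin_ext (\<lambda>(a, b). counit K (bvec a) *\<^sub>c bvec b) (tmap f f t)" for t
  proof (induction t rule: tens_induct)
    case (tens b c)
    show ?case
      by (simp only: tmap_tens f contract_left[OF K.counit_linear] contract_left[OF lin(3)] f_simps f_counit)
  qed (simp_all add: f_simps)
  have counit_r: "f (lin_ext (\<lambda>(a, b). counit H (bvec b) *\<^sub>c bvec a) t) =
      lin_ext (\<lambda>(a, b). counit K (bvec b) *\<^sub>c bvec a) (tmap f f t)" for t
  proof (induction t rule: tens_induct)
    case (tens b c)
    show ?case
      by (simp only: tmap_tens f contract_right[OF K.counit_linear] contract_right[OF lin(3)] f_simps f_counit)
  qed (simp_all add: f_simps)
  have anti_l: "f (mult_lin (mult H) (tmap (antipode H) id t)) =
      mult_lin (mult K) (tmap (antipode K) id (tmap f f t))" for t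
  proof (induction t rule: tens_induct)
    case (tens b c)
    show ?case
      by (simp only: tmap_tens lin f clinear_id K.antipode_linear mult_lin_tens bilK f_mult f_antipode id_apply)
  qed (simp_all add: f_simps)
  have anti_r: "f (mult_lin (mult H) (tmap id (antipode H) t)) =
      mult_lin (mult K) (tmap id (antipode K) (tmap f f t))" for t
  proof (induction t rule: tens_induct)
    case (tens b c)
    show ?case
      by (simp only: tmap_tens lin f clinear_id K.antipode_linear mult_lin_tens bilK f_mult f_antipode id_apply)
  qed (simp_all add: f_simps)
  show "hopf_algebra H"
  proof (rule hopf_algebra.intro)
    show "csubspace (null H)"
      unfolding null by (rule csubspace_kernel[OF f(1)])
    show "clinear (\<lambda>x. mult H x y)" "clinear (mult H y)" for y
      using lin(1) by (auto dest: bilinD)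
    show "clinear (comult H)" "cfunctional (counit H)" "clinear (antipode H)"
      by (fact lin)+
    show "mult H x y \<in> null H" if "x \<in> null H" for x y
      using that by (simp add: null f_mult bilin_simps[OF bilK])
    show "mult H x y \<in> null H" if "y \<in> null H" for x y
      using that by (simp add: null f_mult bilin_simps[OF bilK])
    show "comult H x \<in> tnull (null H) (null H)" if "x \<in> null H" for x
      using that unfolding null2 by (simp add: null f_comult clinear_simps[OF K.comult_linear])
    show "counit H x = 0" if "x \<in> null H" for x
      using that by (simp add: null cfunctional_simps[OF K.counit_linear] flip: f_counit)
    show "antipode H x \<in> null H" if "x \<in> null H" for x
      using that by (simp add: null f_antipode clinear_simps[OF K.antipode_linear])
    show "mult H (mult H x y) z - mult H x (mult H y z) \<in> null H" for x y z
      by (simp add: null f_simps f_mult K_eqs)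
    show "mult H (unit H) x - x \<in> null H" "mult H x (unit H) - x \<in> null H" for x
      by (simp_all add: null f_simps f_mult f_unit K_eqs)
    show "tassoc (tmap (comult H) id (comult H x)) - tmap id (comult H) (comult H x)
         \<in> tnull (null H) (tnull (null H) (null H))" for x
      unfolding null3 by (simp only: mem_Collect_eq tmap_simps coassoc diff_self)
    show "lin_ext (\<lambda>(a, b). counit H (bvec a) *\<^sub>c bvec b) (comult H x) - x \<in> null H" for x
      unfolding null by (simp only: mem_Collect_eq f_simps counit_l f_comult K_eqs diff_self)
    show "lin_ext (\<lambda>(a, b). counit H (bvec b) *\<^sub>c bvec a) (comult H x) - x \<in> null H" for x
      unfolding null by (simp only: mem_Collect_eq f_simps counit_r f_comult K_eqs diff_self)
    show "comult H (mult H x y) - tmult (mult H) (comult H x) (comult H y)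
         \<in> tnull (null H) (null H)" for x y
      unfolding null2 by (simp add: f_comult f_tmult f_mult K_eqs)
    show "comult H (unit H) - unit H \<otimes> unit H \<in> tnull (null H) (null H)"
      unfolding null2 by (simp add: f_comult f_unit tmap_tens f K_eqs)
    show "counit H (mult H x y) = counit H x * counit H y" for x y
      by (simp add: f_mult K.counit_mult flip: f_counit)
    show "counit H (unit H) = 1"
      by (simp add: f_unit K.counit_unit flip: f_counit)
    show "mult_lin (mult H) (tmap (antipode H) id (comult H x)) - counit H x *\<^sub>c unit H \<in> null H" for x
      unfolding null by (simp only: mem_Collect_eq f_simps anti_l f_comult K_eqs f_unit f_counit diff_self)
    show "mult_lin (mult H) (tmap id (antipode H) (comult H x)) - counit H x *\<^sub>c unit H \<in> null H" for x
      unfolding null by (simp only: mem_Collect_eq f_simps anti_r f_comult K_eqs f_unit f_counit diff_self)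
  qed
  show "hopf_iso H K f"
    unfolding hopf_iso_def K(2) tnull_trivial
    by (simp add: f null f_mult f_unit f_comult f_counit f_antipode) (metis f(2) surjD)
qed

section \<open>From words to monomials\<close>

lemma bilin_free_mult [simp, intro]: "bilin free_mult"
  unfolding bilin_def free_mult_def
  by (auto intro!: clinearI simp: lin_ext_plus_fun lin_ext_scale_fun)

lemmas free_mult_simps [simp] = bilin_simps[OF bilin_free_mult]

lemma free_mult_bvec [simp]: "free_mult (bvec u) (bvec v) = bvec (u @ v)"
  by (simp add: free_mult_def)

lemma free_mult_assoc: "free_mult (free_mult x y) z = free_mult x (free_mult y z)"
proof (induction x rule: vec_induct)
  case (basis u)
  show ?case
  proof (induction y rule: vec_induct)
    case (basis v)
    show ?case
      by (induction z rule: vec_induct) simp_all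
  qed simp_all
qed simp_all

lemma free_mult_one [simp]: "free_mult (bvec []) x = x" "free_mult x (bvec []) = x"
  by (induction x rule: vec_induct) simp_all

text \<open>The value of a letter, of a word and of a linear combination of words in the deformed algebra.\<close>

fun letter_val :: "letter \<Rightarrow> (nat \<times> int) vec" where
  "letter_val P = pvec"
| "letter_val G = gvec 1"
| "letter_val Ginv = gvec (- 1)"

definition word_val :: "complex \<Rightarrow> letter list \<Rightarrow> (nat \<times> int) vec"
  where "word_val a w = foldr (\<lambda>l. dmult a (letter_val l)) w 1"

definition free_val :: "complex \<Rightarrow> letter list vec \<Rightarrow> (nat \<times> int) vec"
  where "free_val a = lin_ext (word_val a)"

lemma clinear_free_val [simp, intro]: "clinear (free_val a)"
  by (simp add: free_val_def)

lemmas free_val_simps [simp] = clinear_simps[OF clinear_free_val]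

lemma free_val_Nil [simp]: "free_val a (bvec []) = 1"
  by (simp add: free_val_def word_val_def)

lemma free_val_Cons: "free_val a (bvec (l # w)) = dmult a (letter_val l) (free_val a (bvec w))"
  by (simp add: free_val_def word_val_def)

lemma free_val_letter [simp]: "free_val a (bvec [l]) = letter_val l"
  by (simp add: free_val_Cons)

lemma free_val_mult: "free_val a (free_mult x y) = dmult a (free_val a x) (free_val a y)"
proof (induction x rule: vec_induct)
  case (basis u)
  show ?case
  proof (induction y rule: vec_induct)
    case (basis v)
    show ?case
      by (induction u) (simp_all add: free_val_Cons dmult_assoc)
  qed simp_all
qed simp_all

lemma eps_letter_val: "eps (letter_val l) = letter_counit l"
  by (cases l) (simp_all add: eps_bvec)

lemma free_val_counit: "eps (free_val a x) = counit (planck A) x"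
proof (induction x rule: vec_induct)
  case (basis w)
  show ?case
    by (induction w) (simp_all add: planck_def free_val_Cons eps_dmult eps_letter_val)
qed (simp_all add: planck_def)

lemma free_val_letter_antipode: "free_val a (letter_antipode l) = dantipode a (letter_val l)"
proof (cases l)
  case P
  have "dantipode a (left_p a 1) = Sp a"
    by (simp only: dantipode_left_p dantipode_one dmult_one_left)
  then show ?thesis
    by (simp add: P free_val_Cons Sp_def)
qed (simp_all add: dantipode_bvec)

lemma free_val_antipode: "free_val a (antipode (planck A) x) = dantipode a (free_val a x)"
proof (induction x rule: vec_induct)
  case (basis w)
  show ?case
    by (induction w) (simp_all add: planck_def free_val_Cons free_val_mult dantipode_dmult
        free_val_letter_antipode)
qed (simp_all add: planck_def)

lemma free_val_tmult: "tmap (free_val a) (free_val a) (tmult free_mult s t) =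
    tmult (dmult a) (tmap (free_val a) (free_val a) s) (tmap (free_val a) (free_val a) t)"
proof (induction s rule: tens_induct)
  case (tens b c)
  show ?case
  proof (induction t rule: tens_induct)
    case (tens b' c')
    show ?case
      by (simp only: tmult_tens[OF bilin_free_mult] tmult_tens[OF bilin_dmult]
        tmap_tens[OF clinear_free_val clinear_free_val] free_val_mult)
  qed (simp_all del: tens_bvec)
qed simp_all

lemma free_val_letter_comult: "tmap (free_val a) (free_val a) (letter_comult l) = Delta (letter_val l)"
  by (cases l) (simp_all only: letter_comult.simps letter_val.simps Delta_gvec Delta_pvec tmap_simps
    tmap_tens[OF clinear_free_val clinear_free_val] free_val_letter free_val_Nil gvec_0)

lemma free_val_comult:
  "tmap (free_val a) (free_val a) (comult (planck A) x) = Delta (free_val a x)"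
proof (induction x rule: vec_induct)
  case (basis w)
  show ?case
  proof (induction w)
    case Nil
    show ?case
      by (simp add: planck_def Delta_one)
  next
    case (Cons l w)
    then show ?case
      by (simp add: planck_def free_val_Cons free_val_tmult free_val_letter_comult Delta_dmult)
  qed
qed (simp_all add: planck_def)

section \<open>Normal ordering modulo the relations\<close>

lemma csubspace_ideal: "csubspace (planck_ideal A)"
  by (simp add: planck_ideal_def module.subspace_span[OF module_cscale])

lemmas ideal_add = module.subspace_add[OF module_cscale csubspace_ideal]
  and ideal_diff = module.subspace_diff[OF module_cscale csubspace_ideal]
  and ideal_scale = module.subspace_scale[OF module_cscale csubspace_ideal]
  and ideal_neg = module.subspace_neg[OF module_cscale csubspace_ideal]
  and ideal_0 = module.subspace_0[OF module_cscale csubspace_ideal]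

lemma ideal_mult:
  assumes "x \<in> planck_ideal A"
  shows "free_mult y x \<in> planck_ideal A" "free_mult x y \<in> planck_ideal A"
proof -
  let ?B = "{free_mult (free_mult x r) y | x r y. r \<in> planck_relators A}"
  have "cspan ?B \<subseteq> {x. free_mult y x \<in> planck_ideal A}"
  proof (rule module.span_minimal[OF module_cscale])
    show "?B \<subseteq> {x. free_mult y x \<in> planck_ideal A}"
      unfolding planck_ideal_def by (auto simp flip: free_mult_assoc intro!: module.span_base[OF module_cscale]) blast
    show "csubspace {x. free_mult y x \<in> planck_ideal A}"
      by (intro csubspace_vimage csubspace_ideal bilinD bilin_free_mult)
  qed
  then show "free_mult y x \<in> planck_ideal A"
    using assms by (auto simp: planck_ideal_def)
  have "cspan ?B \<subseteq> {x. free_mult x y \<in> planck_ideal A}"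
  proof (rule module.span_minimal[OF module_cscale])
    show "?B \<subseteq> {x. free_mult x y \<in> planck_ideal A}"
      unfolding planck_ideal_def
      by (auto simp: free_mult_assoc intro!: module.span_base[OF module_cscale]) blast
    show "csubspace {x. free_mult x y \<in> planck_ideal A}"
      by (intro csubspace_vimage csubspace_ideal bilinD bilin_free_mult)
  qed
  then show "free_mult x y \<in> planck_ideal A"
    using assms by (auto simp: planck_ideal_def)
qed

lemma relator_in_ideal: "r \<in> planck_relators A \<Longrightarrow> r \<in> planck_ideal A"
  unfolding planck_ideal_def
  by (rule module.span_base[OF module_cscale]) (metis (mono_tags, lifting) free_mult_one mem_Collect_eq)

lemma free_val_ideal: "x \<in> planck_ideal A \<Longrightarrow> free_val (\<i> * A) x = 0"
proof -
  assume x: "x \<in> planck_ideal A"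
  have "free_val (\<i> * A) r = 0" if "r \<in> planck_relators A" for r
    using that unfolding planck_relators_def
    by (elim insertE emptyE; hypsubst)
      (simp_all add: free_val_mult free_val_Cons left_p_gvec bilin_simps[OF bilin_free_mult])
  then have "planck_ideal A \<subseteq> {x. free_val (\<i> * A) x = 0}"
    unfolding planck_ideal_def
    by (intro module.span_minimal[OF module_cscale] csubspace_kernel clinear_free_val)
      (auto simp: free_val_mult)
  then show ?thesis
    using x by blast
qed

text \<open>Words representing \<open>g\<^sup>r\<close> and \<open>p\<^sup>n\<close>. As \<open>p\<^sup>n\<close> is a monomial and not a deformed power, it is
  represented by \<open>P (P - a) \<cdots> (P - (n - 1) a)\<close>. With them, \<open>normal_order\<close> is a linear right inverse
  of \<open>free_val\<close>.\<close>

definition gword :: "int \<Rightarrow> letter list vec"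
  where "gword r = bvec (if 0 \<le> r then replicate (nat r) G else replicate (nat (- r)) Ginv)"

primrec pword :: "complex \<Rightarrow> nat \<Rightarrow> letter list vec"
  where
    "pword a 0 = bvec []"
  | "pword a (Suc n) = free_mult (bvec [P]) (pword a n) - (a * of_nat n) *\<^sub>c pword a n"

definition normal_order :: "complex \<Rightarrow> (nat \<times> int) vec \<Rightarrow> letter list vec"
  where "normal_order a = lin_ext (\<lambda>(n, r). free_mult (gword r) (pword a n))"

lemma clinear_normal_order [simp, intro]: "clinear (normal_order a)"
  by (simp add: normal_order_def)

lemmas normal_order_simps [simp] = clinear_simps[OF clinear_normal_order]

lemma normal_order_bvec: "normal_order a (bvec (n, r)) = free_mult (gword r) (pword a n)"
  by (simp add: normal_order_def)

lemma gword_0 [simp]: "gword 0 = bvec []"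
  by (simp add: gword_def)

lemma free_val_gword: "free_val a (gword r) = gvec r"
proof -
  have "free_val a (bvec (replicate n G)) = gvec (int n)" for n
    by (induction n) (simp_all add: free_val_Cons)
  moreover have "free_val a (bvec (replicate n Ginv)) = gvec (- int n)" for n
    by (induction n) (simp_all add: free_val_Cons)
  ultimately show ?thesis
    by (simp add: gword_def)
qed

lemma free_val_normal_order: "free_val a (normal_order a y) = y"
proof (induction y rule: vec_induct)
  case (basis b)
  obtain n r where b: "b = (n, r)"
    by (cases b)
  have "free_val a (pword a n) = bvec (n, 0)"
    by (induction n) (simp_all add: free_val_mult left_p_bvec)
  then show ?case
    by (simp add: b normal_order_bvec free_val_mult free_val_gword)
qed simp_all

lemma gword_nonneg: "gword (int k) = bvec (replicate k G)"
  by (simp add: gword_def)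

lemma gword_nonpos: "gword (- int k) = bvec (replicate k Ginv)"
  by (cases k) (simp_all add: gword_def nat_add_distrib)

lemma G_gword: "free_mult (bvec [G]) (gword r) - gword (r + 1) \<in> planck_ideal A"
proof (cases r rule: int_cases)
  case (nonneg k)
  have "gword (r + 1) = gword (int (Suc k))"
    by (simp add: nonneg add.commute)
  then show ?thesis
    by (simp only: nonneg gword_nonneg) (simp add: ideal_0)
next
  case (neg k)
  have "bvec [G, Ginv] - bvec [] \<in> planck_ideal A"
    by (rule relator_in_ideal) (simp add: planck_relators_def)
  then have "free_mult (bvec [G, Ginv] - bvec []) (gword (- int k)) \<in> planck_ideal A"
    by (rule ideal_mult)
  moreover have "gword (r + 1) = gword (- int k)"
    by (simp add: neg)
  ultimately show ?thesis
    by (simp only: neg gword_nonpos) simp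
qed

lemma Ginv_gword: "free_mult (bvec [Ginv]) (gword r) - gword (r - 1) \<in> planck_ideal A"
proof (cases "- r" rule: int_cases)
  case (nonneg k)
  then have "gword r = gword (- int k)" "gword (r - 1) = gword (- int (Suc k))"
    by (auto intro: arg_cong[of _ _ gword])
  then show ?thesis
    by (simp only: gword_nonpos) (simp add: ideal_0)
next
  case (neg k)
  then have r: "gword r = gword (int (Suc k))" "gword (r - 1) = gword (int k)"
    by (auto intro: arg_cong[of _ _ gword])
  have "bvec [Ginv, G] - bvec [] \<in> planck_ideal A"
    by (rule relator_in_ideal) (simp add: planck_relators_def)
  then have "free_mult (bvec [Ginv, G] - bvec []) (gword (int k)) \<in> planck_ideal A"
    by (rule ideal_mult)
  then show ?thesis
    by (simp only: r gword_nonneg) simp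
qed

lemma P_G_relation:
  "free_mult (bvec [P]) (bvec [G]) - free_mult (bvec [G]) (bvec [P])
    - (\<i> * A) *\<^sub>c (bvec [G] - free_mult (bvec [G]) (bvec [G])) \<in> planck_ideal A"
  by (rule relator_in_ideal) (simp add: planck_relators_def bilin_simps[OF bilin_free_mult])

lemma P_Ginv_relation:
  "free_mult (bvec [P]) (bvec [Ginv]) - free_mult (bvec [Ginv]) (bvec [P])
    + (\<i> * A) *\<^sub>c (bvec [Ginv] - bvec []) \<in> planck_ideal A"
proof -
  let ?p = "bvec [P]" and ?g = "bvec [G]" and ?h = "bvec [Ginv]" and ?a = "\<i> * A"
  let ?R = "free_mult ?p ?g - free_mult ?g ?p - ?a *\<^sub>c (?g - free_mult ?g ?g)"
  let ?E = "free_mult ?g ?h - bvec []" and ?E' = "free_mult ?h ?g - bvec []"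
  have E: "?E \<in> planck_ideal A" "?E' \<in> planck_ideal A"
    by (rule relator_in_ideal, simp add: planck_relators_def)+
  \<comment> \<open>conjugate the relation by \<open>g\<^sup>-\<^sup>1\<close> and cancel \<open>g g\<^sup>-\<^sup>1\<close> and \<open>g\<^sup>-\<^sup>1 g\<close>\<close>
  have "free_mult (free_mult ?h ?p) ?E - free_mult ?E' (free_mult ?p ?h)
      - ?a *\<^sub>c free_mult ?E' ?h + ?a *\<^sub>c (free_mult ?E' (free_mult ?g ?h) + ?E)
      - free_mult (free_mult ?h ?R) ?h \<in> planck_ideal A"
    by (intro ideal_add ideal_diff ideal_scale ideal_mult E P_G_relation)
  then show ?thesis
    by (simp add: bilin_simps[OF bilin_free_mult] algebra_simps)
qed

text \<open>The commutation rule of \<open>p\<close> with \<open>g\<^sup>r\<close> modulo the ideal, by induction on \<open>r\<close> in both directions.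
  In each step, the element in question is written as a combination of elements of the ideal: the
  relation between \<open>p\<close> and the letter, the induction hypothesis, and the rules for powers of \<open>g\<close>.\<close>

lemma P_gword:
  "free_mult (bvec [P]) (gword r) - free_mult (gword r) (bvec [P])
    - (\<i> * A * of_int r) *\<^sub>c (gword r - gword (r + 1)) \<in> planck_ideal A"
proof (induction r rule: int_induct[of _ 0])
  case base
  show ?case by (simp add: ideal_0)
next
  case (step1 r)
  define a where "a = \<i> * A"
  define p g where "p = (bvec [P] :: letter list vec)" and "g = (bvec [G] :: letter list vec)"
  note IH = step1(2)[folded a_def p_def]
  note R = P_G_relation[of A, folded a_def p_def g_def]
  note E = G_gword[of r A, folded g_def] G_gword[of "r + 1" A, folded g_def]
  have "- free_mult p (free_mult g (gword r) - gword (r + 1))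
      + free_mult (free_mult p g - free_mult g p - a *\<^sub>c (g - free_mult g g)) (gword r)
      + free_mult g (free_mult p (gword r) - free_mult (gword r) p
        - (a * of_int r) *\<^sub>c (gword r - gword (r + 1)))
      + free_mult (free_mult g (gword r) - gword (r + 1)) p
      + (a + a * of_int r) *\<^sub>c (free_mult g (gword r) - gword (r + 1))
      - a *\<^sub>c free_mult g (free_mult g (gword r) - gword (r + 1))
      - (a * of_int r + a) *\<^sub>c (free_mult g (gword (r + 1)) - gword (r + 1 + 1)) \<in> planck_ideal A"
    by (intro ideal_add ideal_diff ideal_scale ideal_neg ideal_mult IH R E)
  then show ?case
    unfolding a_def[symmetric] p_def[symmetric]
    by (simp add: free_mult_assoc algebra_simps cscale_add_left)
next
  case (step2 r)
  define a where "a = \<i> * A"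
  define p h where "p = (bvec [P] :: letter list vec)" and "h = (bvec [Ginv] :: letter list vec)"
  note IH = step2(2)[folded a_def p_def]
  note R = P_Ginv_relation[of A, folded a_def p_def h_def]
  have E: "free_mult h (gword r) - gword (r - 1) \<in> planck_ideal A"
    "free_mult h (gword (r + 1)) - gword r \<in> planck_ideal A"
    using Ginv_gword[of r A] Ginv_gword[of "r + 1" A] by (simp_all add: h_def)
  have "- free_mult p (free_mult h (gword r) - gword (r - 1))
      + free_mult (free_mult p h - free_mult h p + a *\<^sub>c (h - bvec [])) (gword r)
      + free_mult h (free_mult p (gword r) - free_mult (gword r) p
        - (a * of_int r) *\<^sub>c (gword r - gword (r + 1)))
      + free_mult (free_mult h (gword r) - gword (r - 1)) p
      + (a * of_int r - a) *\<^sub>c (free_mult h (gword r) - gword (r - 1))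
      - (a * of_int r) *\<^sub>c (free_mult h (gword (r + 1)) - gword r) \<in> planck_ideal A"
    by (intro ideal_add ideal_diff ideal_scale ideal_neg ideal_mult IH R E)
  then show ?case
    unfolding a_def[symmetric] p_def[symmetric]
    by (simp add: free_mult_assoc algebra_simps cscale_add_left cscale_diff_left)
qed

text \<open>Putting a letter in front of a normally ordered element and reordering agrees, modulo the
  ideal, with multiplication by the letter's value in the deformed algebra.\<close>

lemma letter_normal_order:
  "free_mult (bvec [l]) (normal_order (\<i> * A) y) - normal_order (\<i> * A) (dmult (\<i> * A) (letter_val l) y)
    \<in> planck_ideal A"
proof (induction y rule: vec_induct)
  case zero
  show ?case by (simp add: ideal_0)
next
  case (add x y)
  then show ?case
    using ideal_add[OF add] by (simp add: algebra_simps)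
next
  case (scale c x)
  then show ?case
    using ideal_scale[OF scale, of c] by (simp add: algebra_simps)
next
  case (basis b)
  obtain n r where b: "b = (n, r)"
    by (cases b)
  show ?case
  proof (cases l)
    case P
    have "free_mult (free_mult (bvec [P]) (gword r) - free_mult (gword r) (bvec [P])
      - (\<i> * A * of_int r) *\<^sub>c (gword r - gword (r + 1))) (pword (\<i> * A) n) \<in> planck_ideal A"
      by (rule ideal_mult(2)[OF P_gword])
    then show ?thesis
      by (simp add: P b left_p_bvec normal_order_bvec free_mult_assoc algebra_simps cscale_add_left)
  next
    case G
    show ?thesis
      using ideal_mult(2)[OF G_gword[of r A], of "pword (\<i> * A) n"]
      by (simp add: G b normal_order_bvec free_mult_assoc add.commute)
  next
    case Ginv
    show ?thesis
      using ideal_mult(2)[OF Ginv_gword[of r A], of "pword (\<i> * A) n"]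
      by (simp add: Ginv b normal_order_bvec free_mult_assoc)
  qed
qed

lemma normal_order_free_val:
  "x - normal_order (\<i> * A) (free_val (\<i> * A) x) \<in> planck_ideal A"
proof (induction x rule: vec_induct)
  case zero
  show ?case by (simp add: ideal_0)
next
  case (add x y)
  then show ?case
    using ideal_add[OF add] by (simp add: algebra_simps)
next
  case (scale c x)
  then show ?case
    using ideal_scale[OF scale, of c] by (simp add: algebra_simps)
next
  case (basis w)
  show ?case
  proof (induction w)
    case Nil
    show ?case
      using normal_order_bvec[of "\<i> * A" 0 0] by (simp add: ideal_0)
  next
    case (Cons l w)
    let ?N = "normal_order (\<i> * A) (free_val (\<i> * A) (bvec w))"
    have "free_mult (bvec [l]) (bvec w - ?N) +
        (free_mult (bvec [l]) ?N - normal_order (\<i> * A) (dmult (\<i> * A) (letter_val l) (free_val (\<i> * A) (bvec w))))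
        \<in> planck_ideal A"
      by (intro ideal_add ideal_mult(1) Cons letter_normal_order)
    then show ?case
      by (simp add: free_val_Cons)
  qed
qed

lemma planck_ideal_eq_kernel: "planck_ideal A = {x. free_val (\<i> * A) x = 0}"
proof -
  have "x \<in> planck_ideal A" if "free_val (\<i> * A) x = 0" for x
    using normal_order_free_val[of x A] by (simp add: that)
  then show ?thesis
    using free_val_ideal by blast
qed

lemma hopf_planck:
  "hopf_algebra (planck A)" "hopf_iso (planck A) (planck_model (\<i> * A)) (free_val (\<i> * A))"
proof -
  have 1: "surj (free_val (\<i> * A))"
    by (metis free_val_normal_order surjI)
  have 2: "null (planck A) = {x. free_val (\<i> * A) x = 0}"
    by (simp add: planck_def planck_ideal_eq_kernel)
  have 3: "mult (planck A) = free_mult" "unit (planck A) = bvec []"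
    "clinear (comult (planck A))" "cfunctional (counit (planck A))" "clinear (antipode (planck A))"
    by (simp_all add: planck_def)
  note * = hopf_transfer[OF hopf_algebra_planck_model planck_model_simps(1) clinear_free_val 1 2]
  show "hopf_algebra (planck A)" "hopf_iso (planck A) (planck_model (\<i> * A)) (free_val (\<i> * A))"
    by (rule *; simp add: 3 free_val_mult free_val_comult free_val_counit free_val_antipode)+
qed

theorem proposition4p1:
  fixes hbar GG A :: complex
  assumes "GG \<noteq> 0" and "A = hbar / GG"
  shows "hopf_algebra CB
    \<and> unital_2_cocycle CB (chi A)
    \<and> conv_inverse CB (chi A) (chi_inv A)
    \<and> hopf_algebra (planck A)
    \<and> hopf_algebra (cocycle_twist CB (chi A) (chi_inv A))
    \<and> (\<exists>\<phi>. hopf_iso (planck A) (cocycle_twist CB (chi A) (chi_inv A)) \<phi>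
          \<and> \<phi> (bvec [P]) = bvec (1, 0)
          \<and> \<phi> (bvec [G]) = bvec (0, 1)
          \<and> \<phi> (bvec [Ginv]) = bvec (0, - 1))"
proof (intro conjI exI)
  show "hopf_algebra CB"
    using hopf_algebra_planck_model[of 0] by (simp only: planck_model_0)
  show "unital_2_cocycle CB (chi A)"
    by (simp only: chi_eq_gpair unital_2_cocycle_gpair)
  show "conv_inverse CB (chi A) (chi_inv A)"
    using conv_inverse_gpair[of "\<i> * A" "- 1"] by (simp add: chi_eq_gpair chi_inv_eq_gpair)
  show "hopf_algebra (planck A)"
    by (rule hopf_planck)
  show "hopf_algebra (cocycle_twist CB (chi A) (chi_inv A))"
    by (simp only: cocycle_twist_eq hopf_algebra_planck_model)
  show "hopf_iso (planck A) (cocycle_twist CB (chi A) (chi_inv A)) (free_val (\<i> * A))"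
    by (simp only: cocycle_twist_eq hopf_planck)
qed simp_all

end
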